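(* Let $b\in PC(\Gamma)$. Then there exists a unique weak solution $m\in V^{1,2}_{\boldsymbol\gamma}(\Gamma)$ to the Fokker–Planck problem (FP) with drift coefficient $b$ (as defined in the context); that is, there exists a unique $m\in V^{1,2}_{\boldsymbol\gamma}(\Gamma)$ such that $$\int_\Gamma \big(\mu\,\partial m\,\partial v+b\,m\,\partial v\big)\,dx=0\quad\text{for every } v\in V^{1,2}(\Gamma),$$ $$m\ge 0,\qquad 1\ge\int_\Gamma m\,dx=1-\sum_{v\in\mathcal V\setminus\partial\mathcal V}\eta_v T_v[m]\ge 0 .$$
   Context: Network. $\mathcal V\subset\mathbb R^d$ is a finite set of vertices; $P\subset\mathcal V\times\mathcal V$ contains no pair $(v,v)$, and every vertex occurs in at least one pair of $P$. The edges are the segments joining the two points of a pair in $P$, indexed as $\Gamma_\alpha$, $\alpha\in\mathcal A$ ($\mathcal A$ finite); for $\alpha\ne\beta$, $\Gamma_\alpha\cap\Gamma_\beta=\{v\}$ if both edges contain the vertex $v$, and $\Gamma_\alpha\cap\Gamma_\beta=\varnothing$ otherwise. The network $\Gamma=\bigcup_{\alpha}\Gamma_\alpha$ is assumed connected and carries its geodesic distance. $\mathcal A_v=\{\alpha\in\mathcal A: v\in\Gamma_\alpha\}$; $\partial\mathcal V$ is the set of boundary vertices, i.e. those $v$ for which there is a unique $\bar v\in\mathcal V$ with $(v,\bar v)\in P$ or $(\bar v,v)\in P$. An edge $\Gamma_\alpha$ with vertices $v_i,v_j$ and length $L_\alpha$ is parametrized by $\pi_\alpha(s)=v_i+s\,e_\alpha$,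 $e_\alpha=(v_j-v_i)/L_\alpha$, $s\in[0,L_\alpha]$. For $u:\Gamma\to\mathbb R$, $u_\alpha=u\circ\pi_\alpha$ on $(0,L_\alpha)$, and $u_{|\Gamma_\alpha}(v)$ is the limit of $u_\alpha$ at the endpoint corresponding to $v\in\Gamma_\alpha$. $\partial u$, $\partial^2u$ inside $\Gamma_\alpha$ are derivatives of $u_\alpha$ with respect to $s$, and $\int_\Gamma f\,dx=\sum_\alpha\int_0^{L_\alpha}f_\alpha\,ds$; $L^p(\Gamma)$ is taken with respect to this measure. Parameters. $\mu_\alpha>0$ for $\alpha\in\mathcal A$ ($\mu$ is the function equal to $\mu_\alpha$ on $\Gamma_\alpha$); $\eta_v\ge0$ for $v\in\mathcal V\setminus\partial\mathcal V$; $\boldsymbol\gamma=\{\gamma_{v,\alpha}\}$ with $\gamma_{v,\alpha}>0$ for $v\in\mathcal V\setminus\partial\mathcal V$, $\alpha\in\mathcal A_v$, and $\sum_{\alpha\in\mathcal A_v}\mu_\alpha\gamma_{v,\alpha}=1$ for all $v\in\mathcal V\setminus\partial\mathcal V$. Spaces. $W^{1,2}(\Gamma)=\{u\in L^2(\Gamma):u_\alpha\in W^{1,2}(0,L_\alpha)\ \forall\alpha\}$ with norm $(\|u\|_{L^2}^2+\|\partial u\|_{L^2}^2)^{1/2}$. $V^{1,2}_{\boldsymbol\gamma}(\Gamma)$ is the subspace (same norm) of $u$ with $u_{|\Gamma_\alpha}(v)/\gamma_{v,\alpha}=u_{|\Gamma_\beta}(v)/\gamma_{v,\beta}$ for all $v\in\mathcal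 V\setminus\partial\mathcal V$ and $\alpha,\beta\in\mathcal A_v$ (no condition at boundary vertices); this common value is denoted $T_v[u]$. $V^{1,2}(\Gamma)$ is the case of all $\gamma_{v,\alpha}=1$, i.e. the elements of $W^{1,2}(\Gamma)$ that are continuous on $\Gamma$. $PC(\Gamma)$ is the space of functions $u$ such that each $u_\alpha$ is continuous on $(0,L_\alpha)$ with finite limits at $0$ and $L_\alpha$, where two functions are identified if they agree on the interior of every edge; its norm is $\max_\alpha\|u_\alpha\|_{L^\infty(0,L_\alpha)}$. Problem (FP). The displayed conditions in the claim are the paper's definition of a weak solution of: $-\mu_\alpha\partial^2m-\partial(bm)=0$ in each edge; $m_{|\Gamma_\alpha}(v)/\gamma_{v,\alpha}=m_{|\Gamma_\beta}(v)/\gamma_{v,\beta}=:T_v[m]$ for $\alpha,\beta\in\mathcal A_v$, $v\in\mathcal V\setminus\partial\mathcal V$; a flux-conservation condition at every vertex; $m\ge0$ and $1\ge\int_\Gamma m\,dx=1-\sum_{v\in\mathcal V\setminus\partial\mathcal V}\eta_vT_v[m]\ge0$. *)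

theory Defs
  imports "HOL-Analysis.Analysis"
begin

section \<open>Networks\<close>

text \<open>
  Edges are indexed by a finite set; \<open>src\<close> and \<open>tgt\<close> give, for each index, the two endpoints of
  the edge in the order chosen for its parametrization (so a pair of vertices may be oriented
  either way, whichever of its two orders occurs in \<open>pairs\<close>).
\<close>

record ('d::finite, 'i) network =
  verts :: "(real ^ 'd) set"
  pairs :: "((real ^ 'd) \<times> (real ^ 'd)) set"
  idx :: "'i set"
  src :: "'i \<Rightarrow> real ^ 'd"
  tgt :: "'i \<Rightarrow> real ^ 'd"

definition edge :: "('d::finite, 'i) network \<Rightarrow> 'i \<Rightarrow> (real ^ 'd) set" where
  "edge N \<alpha> = closed_segment (src N \<alpha>) (tgt N \<alpha>)"

definition edge_length :: "('d::finite, 'i) network \<Rightarrow> 'i \<Rightarrow> real" where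
  "edge_length N \<alpha> = dist (src N \<alpha>) (tgt N \<alpha>)"

definition edge_param :: "('d::finite, 'i) network \<Rightarrow> 'i \<Rightarrow> real \<Rightarrow> real ^ 'd" where
  "edge_param N \<alpha> s = src N \<alpha> + s *\<^sub>R ((tgt N \<alpha> - src N \<alpha>) /\<^sub>R edge_length N \<alpha>)"

text \<open>
  The clause on \<open>verts N \<inter> edge N \<alpha>\<close> says that a vertex lying on an edge is one of its two
  endpoints (no vertex in the interior of an edge); without it ``the endpoint of the edge
  corresponding to the vertex'' would be meaningless.  The intersection clause makes \<open>edge N\<close>
  injective on \<open>idx N\<close>.
\<close>

definition is_network :: "('d::finite, 'i) network \<Rightarrow> bool" where
  "is_network N \<longleftrightarrow>
     finite (verts N) \<and> verts N \<noteq> {} \<and>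
     pairs N \<subseteq> verts N \<times> verts N \<and>
     (\<forall>v. (v, v) \<notin> pairs N) \<and>
     (\<forall>v\<in>verts N. \<exists>w. (v, w) \<in> pairs N \<or> (w, v) \<in> pairs N) \<and>
     finite (idx N) \<and>
     (\<forall>\<alpha>\<in>idx N. (src N \<alpha>, tgt N \<alpha>) \<in> pairs N \<or> (tgt N \<alpha>, src N \<alpha>) \<in> pairs N) \<and>
     edge N ` idx N = (\<lambda>(v, w). closed_segment v w) ` pairs N \<and>
     (\<forall>\<alpha>\<in>idx N. verts N \<inter> edge N \<alpha> = {src N \<alpha>, tgt N \<alpha>}) \<and>
     (\<forall>\<alpha>\<in>idx N. \<forall>\<beta>\<in>idx N. \<alpha> \<noteq> \<beta> \<longrightarrow>
        (\<forall>v\<in>verts N. v \<in> edge N \<alpha> \<and> v \<in> edge N \<beta> \<longrightarrow> edge N \<alpha> \<inter> edge N \<beta> = {v}) \<and>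
        (\<not> (\<exists>v\<in>verts N. v \<in> edge N \<alpha> \<and> v \<in> edge N \<beta>) \<longrightarrow> edge N \<alpha> \<inter> edge N \<beta> = {})) \<and>
     connected (\<Union>\<alpha>\<in>idx N. edge N \<alpha>)"

definition edges_at :: "('d::finite, 'i) network \<Rightarrow> real ^ 'd \<Rightarrow> 'i set" where
  "edges_at N v = {\<alpha> \<in> idx N. v \<in> edge N \<alpha>}"

definition boundary_verts :: "('d::finite, 'i) network \<Rightarrow> (real ^ 'd) set" where
  "boundary_verts N =
     {v \<in> verts N. \<exists>!w. w \<in> verts N \<and> ((v, w) \<in> pairs N \<or> (w, v) \<in> pairs N)}"

abbreviation inner_verts :: "('d::finite, 'i) network \<Rightarrow> (real ^ 'd) set" where
  "inner_verts N \<equiv> verts N - boundary_verts N"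


section \<open>Functions on a network\<close>

text \<open>
  A function on the network is a function on the ambient space of which only the values in the
  interiors of the edges matter, through its edge components \<open>on_edge N u \<alpha>\<close> on
  \<open>{0<..<edge_length N \<alpha>}\<close>.  Elements of Lebesgue and Sobolev spaces are represented by
  arbitrary representatives of their almost-everywhere classes; all notions below are invariant
  under \<open>ae_eq\<close>, which is equality in those spaces.
\<close>

definition on_edge :: "('d::finite, 'i) network \<Rightarrow> (real ^ 'd \<Rightarrow> real) \<Rightarrow> 'i \<Rightarrow> real \<Rightarrow> real" where
  "on_edge N u \<alpha> = (\<lambda>s. u (edge_param N \<alpha> s))"

abbreviation leb_edge :: "('d::finite, 'i) network \<Rightarrow> 'i \<Rightarrow> real measure" where
  "leb_edge N \<alpha> \<equiv> lebesgue_on {0<..<edge_length N \<alpha>}"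

definition ae_on :: "('d::finite, 'i) network \<Rightarrow> (real ^ 'd \<Rightarrow> bool) \<Rightarrow> bool" where
  "ae_on N Q \<longleftrightarrow> (\<forall>\<alpha>\<in>idx N. AE s in leb_edge N \<alpha>. Q (edge_param N \<alpha> s))"

definition ae_eq :: "('d::finite, 'i) network \<Rightarrow> (real ^ 'd \<Rightarrow> real) \<Rightarrow> (real ^ 'd \<Rightarrow> real) \<Rightarrow> bool" where
  "ae_eq N u w \<longleftrightarrow> ae_on N (\<lambda>x. u x = w x)"

definition net_integral :: "('d::finite, 'i) network \<Rightarrow> ('i \<Rightarrow> real \<Rightarrow> real) \<Rightarrow> real" where
  "net_integral N f = (\<Sum>\<alpha>\<in>idx N. \<integral>s. f \<alpha> s \<partial>leb_edge N \<alpha>)"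


subsection \<open>Sobolev spaces\<close>

definition L2_interval :: "real \<Rightarrow> (real \<Rightarrow> real) set" where
  "L2_interval L = {f. f \<in> borel_measurable (lebesgue_on {0<..<L}) \<and>
                       integrable (lebesgue_on {0<..<L}) (\<lambda>s. (f s)\<^sup>2)}"

definition test_fun :: "real \<Rightarrow> (real \<Rightarrow> real) \<Rightarrow> bool" where
  "test_fun L \<phi> \<longleftrightarrow> \<phi> C1_differentiable_on UNIV \<and>
     (\<exists>K. compact K \<and> K \<subseteq> {0<..<L} \<and> (\<forall>s. s \<notin> K \<longrightarrow> \<phi> s = 0))"

text \<open>
  Square-integrable weak derivatives on \<open>{0<..<L}\<close>, tested against compactly supported \<open>C\<^sup>1\<close>
  functions as in Brezis, Functional Analysis, Sobolev Spaces and PDEs, Chapter 8 (smooth test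
  functions give the same notion).  The derivative is unique up to null sets; \<open>weak_deriv\<close> picks
  a representative.
\<close>

definition has_weak_deriv :: "real \<Rightarrow> (real \<Rightarrow> real) \<Rightarrow> (real \<Rightarrow> real) \<Rightarrow> bool" where
  "has_weak_deriv L f g \<longleftrightarrow> g \<in> L2_interval L \<and>
     (\<forall>\<phi>. test_fun L \<phi> \<longrightarrow>
        (\<integral>s. f s * deriv \<phi> s \<partial>lebesgue_on {0<..<L}) = - (\<integral>s. g s * \<phi> s \<partial>lebesgue_on {0<..<L}))"

definition W12_interval :: "real \<Rightarrow> (real \<Rightarrow> real) set" where
  "W12_interval L = {f \<in> L2_interval L. \<exists>g. has_weak_deriv L f g}"

definition weak_deriv :: "real \<Rightarrow> (real \<Rightarrow> real) \<Rightarrow> real \<Rightarrow> real" where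
  "weak_deriv L f = (SOME g. has_weak_deriv L f g)"

definition net_deriv :: "('d::finite, 'i) network \<Rightarrow> (real ^ 'd \<Rightarrow> real) \<Rightarrow> 'i \<Rightarrow> real \<Rightarrow> real" where
  "net_deriv N u \<alpha> = weak_deriv (edge_length N \<alpha>) (on_edge N u \<alpha>)"

definition W12 :: "('d::finite, 'i) network \<Rightarrow> (real ^ 'd \<Rightarrow> real) set" where
  "W12 N = {u. \<forall>\<alpha>\<in>idx N. on_edge N u \<alpha> \<in> W12_interval (edge_length N \<alpha>)}"

text \<open>
  The value at an endpoint \<open>v\<close> of the edge \<open>\<alpha>\<close> is the one-sided limit, at the corresponding end of
  the parameter interval, of the continuous representative of the edge component.
\<close>

definition edge_trace ::
  "('d::finite, 'i) network \<Rightarrow> (real ^ 'd \<Rightarrow> real) \<Rightarrow> 'i \<Rightarrow> real ^ 'd \<Rightarrow> real" where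
  "edge_trace N u \<alpha> v = (THE c. \<exists>w. continuous_on {0<..<edge_length N \<alpha>} w \<and>
      (AE s in leb_edge N \<alpha>. w s = on_edge N u \<alpha> s) \<and>
      (w \<longlongrightarrow> c) (if v = src N \<alpha> then at_right 0 else at_left (edge_length N \<alpha>)))"

definition V12_jump ::
  "('d::finite, 'i) network \<Rightarrow> (real ^ 'd \<Rightarrow> 'i \<Rightarrow> real) \<Rightarrow> (real ^ 'd \<Rightarrow> real) set" where
  "V12_jump N \<gamma> = {u \<in> W12 N. \<forall>v\<in>inner_verts N. \<forall>\<alpha>\<in>edges_at N v. \<forall>\<beta>\<in>edges_at N v.
      edge_trace N u \<alpha> v / \<gamma> v \<alpha> = edge_trace N u \<beta> v / \<gamma> v \<beta>}"

definition V12 :: "('d::finite, 'i) network \<Rightarrow> (real ^ 'd \<Rightarrow> real) set" where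
  "V12 N = V12_jump N (\<lambda>v \<alpha>. 1)"

definition vertex_value ::
  "('d::finite, 'i) network \<Rightarrow> (real ^ 'd \<Rightarrow> 'i \<Rightarrow> real) \<Rightarrow> (real ^ 'd \<Rightarrow> real) \<Rightarrow> real ^ 'd \<Rightarrow> real" where
  "vertex_value N \<gamma> u v = (THE c. \<forall>\<alpha>\<in>edges_at N v. edge_trace N u \<alpha> v / \<gamma> v \<alpha> = c)"


subsection \<open>Piecewise continuous functions\<close>

definition PC :: "('d::finite, 'i) network \<Rightarrow> (real ^ 'd \<Rightarrow> real) set" where
  "PC N = {u. \<forall>\<alpha>\<in>idx N. continuous_on {0<..<edge_length N \<alpha>} (on_edge N u \<alpha>) \<and>
      (\<exists>l. (on_edge N u \<alpha> \<longlongrightarrow> l) (at_right 0)) \<and>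
      (\<exists>l. (on_edge N u \<alpha> \<longlongrightarrow> l) (at_left (edge_length N \<alpha>)))}"


section \<open>The Fokker--Planck problem\<close>

definition fp_parameters ::
  "('d::finite, 'i) network \<Rightarrow> ('i \<Rightarrow> real) \<Rightarrow> (real ^ 'd \<Rightarrow> real) \<Rightarrow> (real ^ 'd \<Rightarrow> 'i \<Rightarrow> real) \<Rightarrow> bool" where
  "fp_parameters N \<mu> \<eta> \<gamma> \<longleftrightarrow>
     (\<forall>\<alpha>\<in>idx N. \<mu> \<alpha> > 0) \<and>
     (\<forall>v\<in>inner_verts N. \<eta> v \<ge> 0) \<and>
     (\<forall>v\<in>inner_verts N. \<forall>\<alpha>\<in>edges_at N v. \<gamma> v \<alpha> > 0) \<and>
     (\<forall>v\<in>inner_verts N. (\<Sum>\<alpha>\<in>edges_at N v. \<mu> \<alpha> * \<gamma> v \<alpha>) = 1)"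

definition fp_weak_solution ::
  "('d::finite, 'i) network \<Rightarrow> ('i \<Rightarrow> real) \<Rightarrow> (real ^ 'd \<Rightarrow> real) \<Rightarrow> (real ^ 'd \<Rightarrow> 'i \<Rightarrow> real) \<Rightarrow>
   (real ^ 'd \<Rightarrow> real) \<Rightarrow> (real ^ 'd \<Rightarrow> real) \<Rightarrow> bool" where
  "fp_weak_solution N \<mu> \<eta> \<gamma> b m \<longleftrightarrow>
     m \<in> V12_jump N \<gamma> \<and>
     (\<forall>v\<in>V12 N. net_integral N (\<lambda>\<alpha> s. \<mu> \<alpha> * net_deriv N m \<alpha> s * net_deriv N v \<alpha> s
                                     + on_edge N b \<alpha> s * on_edge N m \<alpha> s * net_deriv N v \<alpha> s) = 0) \<and>
     ae_on N (\<lambda>x. m x \<ge> 0) \<and>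
     1 \<ge> net_integral N (on_edge N m) \<and>
     net_integral N (on_edge N m) = 1 - (\<Sum>v\<in>inner_verts N. \<eta> v * vertex_value N \<gamma> m v) \<and>
     1 - (\<Sum>v\<in>inner_verts N. \<eta> v * vertex_value N \<gamma> m v) \<ge> 0"

end

theory Submission
  imports Defs
begin

text \<open>
  Testing the weak equation with functions supported inside one edge shows that the total flux
  \<open>\<mu> \<partial>m + b m\<close> is constant there (\<open>du_Bois_Reymond\<close>), so that \<open>m\<close> solves a linear first-order
  equation and is an explicit \<open>profile\<close>, determined by its two end values
  (\<open>profile_unique\<close>, \<open>slope_from_end_value\<close>).  The end values are \<open>\<gamma> v \<alpha> * T v\<close> for an unknown
  function \<open>T\<close> on the vertices, where at a boundary vertex, which lies on a single edge, the
  factor is taken to be 1.  Hence the flux through an edge has the form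
  \<open>p * T (tgt) - q * T (src)\<close> with positive \<open>p\<close> and \<open>q\<close>.  Conversely, any \<open>T\<close> yields a function
  with constant flux on each edge, and testing with functions that interpolate linearly between
  prescribed vertex values shows that it solves the weak equation precisely when the fluxes
  balance at every vertex.  The weak equation is thus equivalent to a finite linear
  system for \<open>T\<close>: the equation for a stationary measure of a Markov chain that jumps along the
  edges of a connected graph.

  This system has a nonzero solution, because its equations add up to zero, so one of them can be
  dropped (\<open>homogeneous_system_nontrivial_solution\<close>).  Testing the balance with
  \<open>\<psi> = sgn T\<close> gives a sum of nonnegative terms, whence \<open>sgn T\<close> is constant along edges and, by
  connectedness, on all vertices (\<open>balanced_sgn\<close>).  Applied to a nonzero solution, this makes it
  positive up to sign; applied to a linear combination of two solutions that vanishes at one vertex, it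
  makes them proportional.  The solutions of the weak equation therefore form a line spanned by a
  positive function.

  On this line the normalisation \<open>\<integral> m = 1 - \<Sum> \<eta> v * T v\<close> reads \<open>k * (\<integral> m\<^sub>0 + \<Sum> \<eta> v * T\<^sub>0 v) = 1\<close>
  with a positive bracket, which fixes the factor \<open>k > 0\<close>; the two inequalities for the mass
  follow from \<open>m \<ge> 0\<close>, \<open>T \<ge> 0\<close> and \<open>\<eta> \<ge> 0\<close>.

  The bridge between weak derivatives and calculus is that the Sobolev functions on an interval
  are, up to null sets, the primitives \<open>C + \<integral>\<^sub>0\<^sup>s g\<close> of square-integrable functions
  (\<open>has_weak_deriv_primitive\<close>, \<open>W12_interval_primitive\<close>), with \<open>C\<close> the trace at the left end.
\<close>

section \<open>Integration on a bounded interval\<close>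
abbreviation leb_ivl :: "real \<Rightarrow> real measure" where
  "leb_ivl L \<equiv> lebesgue_on {0<..<L}"

lemma finite_measure_ivl: "finite_measure (leb_ivl L)"
  by (rule finite_measure_lebesgue_on) (auto intro: bounded_set_imp_lmeasurable)

lemma integrable_const_ivl: "integrable (leb_ivl L) (\<lambda>_. c::real)"
  by (rule finite_measure.integrable_const[OF finite_measure_ivl])

lemma measurable_continuous_on_ivl:
  "continuous_on {0<..<L} f \<Longrightarrow> (f::real\<Rightarrow>real) \<in> borel_measurable (leb_ivl L)"
  by (rule continuous_imp_measurable_on_sets_lebesgue) auto

lemma integrable_mult_bounded:
  fixes f g :: "real \<Rightarrow> real"
  assumes "integrable M f" "g \<in> borel_measurable M" "\<And>x. x \<in> space M \<Longrightarrow> \<bar>g x\<bar> \<le> B"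
  shows "integrable M (\<lambda>x. f x * g x)"
proof -
  have "integrable M (\<lambda>x. \<bar>B\<bar> * f x)" using assms by simp
  then show ?thesis
  proof (rule Bochner_Integration.integrable_bound)
    show "(\<lambda>x. f x * g x) \<in> borel_measurable M" using assms by measurable
    show "AE x in M. norm (f x * g x) \<le> norm (\<bar>B\<bar> * f x)"
    proof (intro AE_I2)
      fix x assume "x \<in> space M"
      then have "\<bar>g x\<bar> \<le> \<bar>B\<bar>" using assms(3)[of x] by linarith
      then show "norm (f x * g x) \<le> norm (\<bar>B\<bar> * f x)"
        using mult_right_mono[of "\<bar>g x\<bar>" "\<bar>B\<bar>" "\<bar>f x\<bar>"] by (simp add: abs_mult mult.commute)
    qed
  qed
qed

lemma integrable_mult_continuous:
  fixes f g :: "real \<Rightarrow> real"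
  assumes "integrable (leb_ivl L) f" "continuous_on {0..L} g"
  shows "integrable (leb_ivl L) (\<lambda>x. f x * g x)"
proof -
  have "bounded (g ` {0..L})" using assms(2) compact_continuous_image compact_imp_bounded compact_Icc by metis
  then obtain B where "\<forall>x\<in>{0..L}. \<bar>g x\<bar> \<le> B" by (auto simp: bounded_iff)
  then show ?thesis
    using assms by (intro integrable_mult_bounded[where B=B] measurable_continuous_on_ivl)
     (auto intro: continuous_on_subset)
qed

lemma integrable_continuous_ivl:
  "continuous_on {0..L} (g::real\<Rightarrow>real) \<Longrightarrow> integrable (leb_ivl L) g"
  using integrable_mult_continuous[of L "\<lambda>_. 1" g] integrable_const_ivl[of L 1] by simp

lemma integral_ivl_eq:
  assumes "integrable (leb_ivl L) (f::real\<Rightarrow>real)"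
  shows "integral\<^sup>L (leb_ivl L) f = integral {0..L} f"
  using lebesgue_integral_eq_integral[OF assms] by (simp add: integral_open_interval_real)

lemma integrable_on_ivl:
  assumes "integrable (leb_ivl L) (f::real\<Rightarrow>real)"
  shows "f integrable_on {0..L}"
  using integrable_on_lebesgue_on[OF assms] integrable_on_open_interval_real[of f 0 L] by simp

lemma L2_imp_integrable: "g \<in> L2_interval L \<Longrightarrow> integrable (leb_ivl L) g"
  unfolding L2_interval_def
  by (auto intro: finite_measure.square_integrable_imp_integrable[OF finite_measure_ivl])

lemma L2_imp_measurable: "g \<in> L2_interval L \<Longrightarrow> g \<in> borel_measurable (leb_ivl L)"
  by (simp add: L2_interval_def)

lemma continuous_imp_L2: "continuous_on {0..L} g \<Longrightarrow> g \<in> L2_interval L"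
  unfolding L2_interval_def
  by (auto intro!: measurable_continuous_on_ivl integrable_continuous_ivl continuous_intros
      intro: continuous_on_subset)

lemma test_fun_support:
  assumes "test_fun L \<phi>"
  obtains a b where "0 < a" "a < b" "b < L" "\<And>s. s \<notin> {a..b} \<Longrightarrow> \<phi> s = 0" | "\<And>s. \<phi> s = 0"
proof -
  obtain K where K: "compact K" "K \<subseteq> {0<..<L}" "\<And>s. s \<notin> K \<Longrightarrow> \<phi> s = 0"
    using assms by (auto simp: test_fun_def)
  show thesis
  proof (cases "K = {}")
    case True then show thesis using K that by auto
  next
    case False
    obtain a where a: "a \<in> K" "\<And>x. x \<in> K \<Longrightarrow> a \<le> x" using compact_attains_inf[OF K(1) False] by auto
    obtain b where b: "b \<in> K" "\<And>x. x \<in> K \<Longrightarrow> x \<le> b" using compact_attains_sup[OF K(1) False] by auto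
    have ab: "0 < a" "a \<le> b" "b < L" using a b K(2) by auto
    \<comment> \<open>The support may be a single point; enlarging it to the right gives \<open>a < b\<close>.\<close>
    show thesis
    proof (rule that(1)[of "a" "(b+L)/2"])
      show "\<phi> s = 0" if "s \<notin> {a..(b + L)/2}" for s
      proof (rule K(3))
        show "s \<notin> K" using that a(2)[of s] b(2)[of s] ab by auto
      qed
    qed (use ab in auto)
  qed
qed

lemma test_fun_deriv:
  assumes "test_fun L \<phi>"
  shows "(\<phi> has_real_derivative deriv \<phi> s) (at s)" "continuous_on S (deriv \<phi>)"
    "continuous_on S \<phi>"
proof -
  obtain D where D: "\<And>x. (\<phi> has_vector_derivative D x) (at x)" "continuous_on UNIV D"
    using assms by (auto simp: test_fun_def C1_differentiable_on_def)
  have "deriv \<phi> = D" using D(1) by (auto simp: has_real_derivative_iff_has_vector_derivative intro!: DERIV_imp_deriv)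
  then show 1: "(\<phi> has_real_derivative deriv \<phi> s) (at s)" "continuous_on S (deriv \<phi>)" for s
    using D by (auto simp: has_real_derivative_iff_has_vector_derivative intro: continuous_on_subset)
  show "continuous_on S \<phi>"
    using 1(1) DERIV_isCont continuous_at_imp_continuous_on by blast
qed

lemma test_fun_zero_left: "test_fun L \<phi> \<Longrightarrow> s \<le> 0 \<Longrightarrow> \<phi> s = 0"
  by (force simp: test_fun_def)
lemma test_fun_zero_right: "test_fun L \<phi> \<Longrightarrow> s \<ge> L \<Longrightarrow> \<phi> s = 0"
  by (force simp: test_fun_def)

section \<open>Test functions and the fundamental lemma\<close>

text \<open>
  The squares make the cutoff continuously differentiable.  It is positive exactly on
  \<open>{a<..<b}\<close>, so its products with polynomials are test functions rich enough to detect every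
  integrable function on that interval.
\<close>
definition cutoff :: "real \<Rightarrow> real \<Rightarrow> real \<Rightarrow> real" where
  "cutoff a b s = (max 0 (s - a))\<^sup>2 * (max 0 (b - s))\<^sup>2"

lemma max_sq_deriv: "((\<lambda>s::real. (max 0 s)\<^sup>2) has_real_derivative 2 * max 0 s) (at s)"
proof (cases s "0::real" rule: linorder_cases)
  case less
  have "((\<lambda>s::real. 0) has_real_derivative 2 * max 0 s) (at s)" using less by simp
  then show ?thesis
    by (rule has_field_derivative_transform_within_open[of _ _ _ "{..<0}"]) (use less in auto)
next
  case greater
  have "((\<lambda>s::real. s\<^sup>2) has_real_derivative 2 * max 0 s) (at s)" using greater
    by (auto intro!: derivative_eq_intros)
  then show ?thesis
    by (rule has_field_derivative_transform_within_open[of _ _ _ "{0<..}"]) (use greater in auto)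
next
  case equal
  have "((\<lambda>h::real. (max 0 h)\<^sup>2 / h) \<longlongrightarrow> 0) (at 0)"
  proof (rule Lim_null_comparison)
    show "\<forall>\<^sub>F x in at 0. norm ((max 0 x)\<^sup>2 / x) \<le> \<bar>x::real\<bar>"
      by (rule always_eventually) (auto simp: max_def power2_eq_square)
    show "((\<lambda>x::real. \<bar>x\<bar>) \<longlongrightarrow> 0) (at 0)"  by (intro tendsto_rabs_zero) (rule tendsto_ident_at)
  qed
  then show ?thesis using equal by (simp add: DERIV_def)
qed

lemma test_fun_mult_cutoff:
  assumes p: "\<And>s. (p has_real_derivative p' s) (at s)" "continuous_on UNIV p'"
    and ab: "0 < a" "b < L"
  shows "test_fun L (\<lambda>s. p s * cutoff a b s)"
proof -
  define D where "D = (\<lambda>s. p' s * cutoff a b s +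
      p s * (2 * max 0 (s - a) * (max 0 (b - s))\<^sup>2 - (max 0 (s - a))\<^sup>2 * (2 * max 0 (b - s))))"
  have 1: "((\<lambda>s. (max 0 (s - a))\<^sup>2) has_real_derivative 2 * max 0 (s - a)) (at s)" for s
    using DERIV_shift[of "\<lambda>s. (max 0 s)\<^sup>2" "2 * max 0 (s - a)" s "-a"] max_sq_deriv[of "s - a"] by simp
  have 2: "((\<lambda>s. (max 0 (b - s))\<^sup>2) has_real_derivative - (2 * max 0 (b - s))) (at s)" for s
  proof -
    have "((\<lambda>s. b - s) has_real_derivative - 1) (at s)" by (auto intro!: derivative_eq_intros)
    from DERIV_chain2[OF max_sq_deriv this] show ?thesis by simp
  qed
  have d: "((\<lambda>s. p s * cutoff a b s) has_real_derivative D s) (at s)" for s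
    unfolding D_def cutoff_def
    by (rule derivative_eq_intros p 1 2 refl)+ (simp add: algebra_simps)
  have cp: "continuous_on UNIV p" using p(1) DERIV_isCont continuous_at_imp_continuous_on by blast
  have "continuous_on UNIV D" unfolding D_def cutoff_def
    by (intro continuous_intros p(2) cp)
  then have "(\<lambda>s. p s * cutoff a b s) C1_differentiable_on UNIV"
    using d by (auto simp: C1_differentiable_on_def has_real_derivative_iff_has_vector_derivative)
  moreover have "p s * cutoff a b s = 0" if "s \<notin> {a..b}" for s
    using that by (auto simp: cutoff_def)
  ultimately show ?thesis unfolding test_fun_def using ab by (intro conjI exI[of _ "{a..b}"]) auto
qed

text \<open>
  The function \<open>sgn K\<close> is an almost-everywhere limit of continuous functions; clipping these to
  \<open>{-1..1}\<close> lets dominated convergence turn orthogonality into \<open>\<integral> \<bar>K\<bar> = 0\<close>.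
\<close>
lemma AE_zero_if_orthogonal_to_continuous:
  assumes K: "integrable (leb_ivl L) (K::real\<Rightarrow>real)"
    and orth: "\<And>\<psi>. continuous_on UNIV \<psi> \<Longrightarrow> (\<integral>s. K s * \<psi> s \<partial>leb_ivl L) = 0"
  shows "AE s in leb_ivl L. K s = 0"
proof -
  let ?M = "leb_ivl L"
  have "(\<lambda>s. sgn (K s)) \<in> borel_measurable ?M" using K by measurable
  then have "(\<lambda>s. sgn (K s)) measurable_on {0<..<L}"
    by (simp add: measurable_on_iff_borel_measurable)
  then obtain Z g where Z: "negligible Z" and g: "\<And>n::nat. continuous_on UNIV (g n)"
    and lim: "\<And>x. x \<notin> Z \<Longrightarrow> (\<lambda>n. g n x) \<longlonglongrightarrow> (if x \<in> {0<..<L} then sgn (K x) else 0)"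
    unfolding measurable_on_def by blast
  define \<psi> where "\<psi> n x = max (-1) (min 1 (g n x))" for n x
  have c\<psi>: "continuous_on UNIV (\<psi> n)" for n
    unfolding \<psi>_def by (intro continuous_intros g)
  have "Z \<in> null_sets lebesgue" using Z by (simp add: negligible_iff_null_sets)
  then have "AE s in lebesgue. s \<notin> Z" by (rule AE_not_in)
  then have AEZ: "AE s in ?M. s \<notin> Z" by (subst AE_restrict_space_iff) auto
  have "(\<lambda>n. \<integral>s. K s * \<psi> n s \<partial>?M) \<longlonglongrightarrow> (\<integral>s. \<bar>K s\<bar> \<partial>?M)"
  proof (rule integral_dominated_convergence)
    show "(\<lambda>s. \<bar>K s\<bar>) \<in> borel_measurable ?M" "integrable ?M (\<lambda>s. \<bar>K s\<bar>)" using K by auto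
    show "(\<lambda>s. K s * \<psi> n s) \<in> borel_measurable ?M" for n
      using K measurable_continuous_on_ivl[of L "\<psi> n"] c\<psi>[of n]
      by (intro borel_measurable_times) (auto intro: continuous_on_subset)
    show "AE x in ?M. norm (K x * \<psi> n x) \<le> \<bar>K x\<bar>" for n
      by (intro AE_I2) (auto simp: abs_mult \<psi>_def intro!: mult_left_le)
    have "(\<lambda>n. K x * \<psi> n x) \<longlonglongrightarrow> \<bar>K x\<bar>" if x: "x \<notin> Z" "x \<in> {0<..<L}" for x
    proof -
      have "(\<lambda>n. K x * \<psi> n x) \<longlonglongrightarrow> K x * max (-1) (min 1 (sgn (K x)))"
        unfolding \<psi>_def using lim[OF x(1)] x(2) by (intro tendsto_intros) auto
      moreover have "K x * max (-1) (min 1 (sgn (K x))) = \<bar>K x\<bar>"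
        by (auto simp: sgn_if)
      ultimately show ?thesis by simp
    qed
    then show "AE x in ?M. (\<lambda>n. K x * \<psi> n x) \<longlonglongrightarrow> \<bar>K x\<bar>"
      by (rule lebesgue_on_mono[OF AEZ])
  qed
  then have "(\<integral>s. \<bar>K s\<bar> \<partial>?M) = 0"
    by (simp add: orth[OF c\<psi>] LIMSEQ_const_iff)
  then show ?thesis using K by (subst (asm) integral_nonneg_eq_0_iff_AE) auto
qed

text \<open>
  By the Weierstrass theorem, orthogonality to polynomials times a cutoff makes \<open>k\<close> times the
  cutoff orthogonal to all continuous functions, hence zero.  The cutoffs to
  \<open>{1/n..L - 1/n}\<close> then exhaust the interval.
\<close>
lemma AE_zero_if_orthogonal_to_test_fun:
  assumes k: "integrable (leb_ivl L) (k::real\<Rightarrow>real)"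
    and orth: "\<And>\<phi>. test_fun L \<phi> \<Longrightarrow> (\<integral>s. k s * \<phi> s \<partial>leb_ivl L) = 0"
  shows "AE s in leb_ivl L. k s = 0"
proof -
  let ?M = "leb_ivl L"
  \<comment> \<open>Polynomials approximate \<open>\<psi>\<close> uniformly, and each of them gives the integral zero.\<close>
  have main: "AE s in ?M. k s * cutoff a b s = 0" if ab: "0 < a" "b < L" for a b
  proof (rule AE_zero_if_orthogonal_to_continuous)
    have cc: "continuous_on S (cutoff a b)" for S
      unfolding cutoff_def by (intro continuous_intros)
    show int: "integrable ?M (\<lambda>s. k s * cutoff a b s)"
      by (rule integrable_mult_continuous[OF k cc])
    fix \<psi> :: "real \<Rightarrow> real" assume \<psi>: "continuous_on UNIV \<psi>"
    let ?I = "\<integral>s. \<bar>k s * cutoff a b s\<bar> \<partial>?M"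
    have I0: "?I \<ge> 0" by simp
    have c\<psi>: "continuous_on {0..L} \<psi>" using \<psi> continuous_on_subset by blast
    have "\<bar>\<integral>s. k s * cutoff a b s * \<psi> s \<partial>?M\<bar> \<le> e * ?I" if "e > 0" for e
    proof -
      obtain p where p: "real_polynomial_function p" "\<And>x. x \<in> {0..L} \<Longrightarrow> \<bar>\<psi> x - p x\<bar> < e"
        using Stone_Weierstrass_real_polynomial_function[OF compact_Icc c\<psi> \<open>e > 0\<close>] by blast
      obtain p' where p': "polynomial_function p'" "\<And>x. (p has_vector_derivative p' x) (at x)"
        using has_vector_derivative_polynomial_function p(1) real_polynomial_function_eq by metis
      have pt: "test_fun L (\<lambda>s. p s * cutoff a b s)"
        using p' ab by (intro test_fun_mult_cutoff[where p'=p'])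
          (auto simp: has_real_derivative_iff_has_vector_derivative continuous_on_polymonial_function)
      have cp: "continuous_on {0..L} p"
        using p(1) real_polynomial_function_eq continuous_on_polymonial_function by blast
      have 0: "(\<integral>s. k s * cutoff a b s * p s \<partial>?M) = 0"
        using orth[OF pt] by (simp add: mult_ac)
      have i1: "integrable ?M (\<lambda>s. k s * cutoff a b s * \<psi> s)"
        by (rule integrable_mult_continuous[OF int c\<psi>])
      have i2: "integrable ?M (\<lambda>s. k s * cutoff a b s * p s)"
        by (rule integrable_mult_continuous[OF int cp])
      have "(\<integral>s. k s * cutoff a b s * \<psi> s \<partial>?M) = (\<integral>s. k s * cutoff a b s * \<psi> s - k s * cutoff a b s * p s \<partial>?M)"
        using i1 i2 0 by simp
      also have "\<bar>\<dots>\<bar> \<le> (\<integral>s. e * \<bar>k s * cutoff a b s\<bar> \<partial>?M)"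
      proof (rule integral_abs_bound_integral)
        show "integrable ?M (\<lambda>s. k s * cutoff a b s * \<psi> s - k s * cutoff a b s * p s)"
          using i1 i2 by simp
        show "integrable ?M (\<lambda>s. e * \<bar>k s * cutoff a b s\<bar>)" using int by simp
        fix x assume "x \<in> space ?M"
        then have "\<bar>\<psi> x - p x\<bar> \<le> e" using p(2)[of x] by simp
        moreover have "\<bar>k x * cutoff a b x * \<psi> x - k x * cutoff a b x * p x\<bar> = \<bar>\<psi> x - p x\<bar> * \<bar>k x * cutoff a b x\<bar>"
          by (simp add: abs_mult[symmetric] algebra_simps)
        ultimately show "\<bar>k x * cutoff a b x * \<psi> x - k x * cutoff a b x * p x\<bar> \<le> e * \<bar>k x * cutoff a b x\<bar>"
          by (simp add: mult_right_mono)
      qed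
      finally show ?thesis by simp
    qed
    note bd = this
    have "\<bar>\<integral>s. k s * cutoff a b s * \<psi> s \<partial>?M\<bar> \<le> 0"
    proof (rule field_le_epsilon)
      fix e :: real assume e: "e > 0"
      \<comment> \<open>The summand 1 covers the case that the integral \<open>?I\<close> vanishes.\<close>
      have "e / (?I + 1) * ?I \<le> e"
      proof -
        have "0 < ?I + 1" using I0 by linarith
        then show ?thesis using e by (simp add: pos_divide_le_eq algebra_simps)
      qed
      then show "\<bar>\<integral>s. k s * cutoff a b s * \<psi> s \<partial>?M\<bar> \<le> 0 + e"
        using bd[of "e / (?I + 1)"] I0 e by (smt (verit) divide_pos_pos)
    qed
    then show "(\<integral>s. k s * cutoff a b s * \<psi> s \<partial>?M) = 0" by simp
  qed
  have "AE s in ?M. \<forall>n. k s * cutoff (inverse (real (Suc n))) (L - inverse (real (Suc n))) s = 0"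
    unfolding AE_all_countable by (intro allI main) auto
  then show ?thesis
  proof (rule lebesgue_on_mono)
    fix s assume s: "\<forall>n. k s * cutoff (inverse (real (Suc n))) (L - inverse (real (Suc n))) s = 0" "s \<in> {0<..<L}"
    then obtain n where "inverse (real (Suc n)) < min s (L - s)"
      using reals_Archimedean[of "min s (L - s)"] by auto
    then have "cutoff (inverse (real (Suc n))) (L - inverse (real (Suc n))) s \<noteq> 0"
      by (simp add: cutoff_def max_def)
    then show "k s = 0" using s(1) by (metis mult_eq_0_iff)
  qed
qed

text \<open>
  The derivatives of test functions are the continuous functions of compact support and mean
  zero; the mean-zero condition is what makes the antiderivative vanish to the right of the
  support as well.
\<close>
lemma test_fun_antiderivative:
  assumes \<theta>: "continuous_on UNIV \<theta>" and ab: "0 < a" "a < b" "b < L"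
    and supp: "\<And>s. s \<notin> {a..b} \<Longrightarrow> \<theta> s = 0" and mean: "(\<integral>s. \<theta> s \<partial>leb_ivl L) = 0"
  obtains \<Theta> where "test_fun L \<Theta>" "deriv \<Theta> = \<theta>"
proof -
  have "isCont \<theta> x" for x using \<theta> by (simp add: continuous_on_eq_continuous_at)
  then obtain F where F: "\<And>x. (F has_vector_derivative \<theta> x) (at x)"
    using einterval_antiderivative[of "-\<infinity>" "\<infinity>" \<theta>] by auto
  define \<Theta> where "\<Theta> s = F s - F a" for s
  have d: "(\<Theta> has_real_derivative \<theta> x) (at x)" for x
    unfolding \<Theta>_def using F[of x] 
    by (auto simp: has_real_derivative_iff_has_vector_derivative[symmetric] intro!: derivative_eq_intros)
  have const: "\<Theta> x = \<Theta> y" if "x < y" "\<And>z. x < z \<Longrightarrow> z < y \<Longrightarrow> \<theta> z = 0" for x y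
  proof -
    have "continuous_on {x..y} \<Theta>" using d DERIV_isCont continuous_at_imp_continuous_on by blast
    then show ?thesis
      using DERIV_isconst_end[of x y \<Theta>] d that by metis
  qed
  have left: "\<Theta> s = 0" if "s < a" for s
    using const[OF that] supp by (simp add: \<Theta>_def)
  have ftc: "(\<theta> has_integral (\<Theta> y - \<Theta> x)) {x..y}" if "x \<le> y" for x y
    using that d by (intro fundamental_theorem_of_calculus) (auto simp: has_real_derivative_iff_has_vector_derivative
      intro: has_vector_derivative_at_within)
  have "integrable (leb_ivl L) \<theta>" by (rule integrable_continuous_ivl) (use \<theta> continuous_on_subset in blast)
  then have "\<Theta> L - \<Theta> 0 = 0"
    using ftc[of 0 L] mean ab by (simp add: integral_ivl_eq integral_unique)
  then have "\<Theta> L = 0" using left[of 0] ab by simp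
  moreover have "\<Theta> L = \<Theta> b" using const[of b L] ab supp by auto
  ultimately have b: "\<Theta> b = 0" by simp
  have right: "\<Theta> s = 0" if "s > b" for s
    using const[of b s] that supp b by auto
  have "test_fun L \<Theta>" unfolding test_fun_def C1_differentiable_on_def
    using d \<theta> left right ab
    by (intro conjI exI[of _ \<theta>] exI[of _ "{a..b}"])
      (auto simp: has_real_derivative_iff_has_vector_derivative not_le)
  moreover have "deriv \<Theta> = \<theta>" using d by (auto intro: DERIV_imp_deriv)
  ultimately show thesis by (rule that)
qed

text \<open>
  A test function \<open>\<phi>\<close> minus the multiple of a fixed bump \<open>\<rho>\<close> with the same integral is the
  derivative of a test function.  Orthogonality to such derivatives says that \<open>h - c\<close> is
  orthogonal to \<open>\<phi>\<close>, where \<open>c\<close> is the \<open>\<rho>\<close>-average of \<open>h\<close>.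
\<close>
lemma du_Bois_Reymond:
  assumes L: "0 < L" and h: "integrable (leb_ivl L) (h::real\<Rightarrow>real)"
    and orth: "\<And>\<phi>. test_fun L \<phi> \<Longrightarrow> (\<integral>s. h s * deriv \<phi> s \<partial>leb_ivl L) = 0"
  obtains c where "AE s in leb_ivl L. h s = c"
proof -
  let ?M = "leb_ivl L"
  define \<rho> where "\<rho> = cutoff (L/3) (2*L/3)"
  have c\<rho>: "continuous_on S \<rho>" for S unfolding \<rho>_def cutoff_def by (intro continuous_intros)
  define I where "I = (\<integral>s. \<rho> s \<partial>?M)"
  have i\<rho>: "integrable ?M \<rho>" by (rule integrable_continuous_ivl[OF c\<rho>])
  have I: "I \<noteq> 0"
  proof
    assume "I = 0"
    then have "integral {0..L} \<rho> = 0" using integral_ivl_eq[OF i\<rho>] by (simp add: I_def)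
    then have "\<forall>x\<in>{0..L}. \<rho> x = 0"
      using c\<rho> L by (subst (asm) integral_eq_0_iff) (auto simp: \<rho>_def cutoff_def)
    then have "\<rho> (L/2) = 0" using L by auto
    then show False using L by (auto simp: \<rho>_def cutoff_def max_def field_simps split: if_splits)
  qed
  define c where "c = (\<integral>s. h s * \<rho> s \<partial>?M) / I"
  have "AE s in ?M. h s - c = 0"
  proof (rule AE_zero_if_orthogonal_to_test_fun)
    show "integrable ?M (\<lambda>s. h s - c)"
      using h integrable_const_ivl by simp
    fix \<phi> assume \<phi>: "test_fun L \<phi>"
    have c\<phi>: "continuous_on S \<phi>" for S by (rule test_fun_deriv[OF \<phi>])
    have i\<phi>: "integrable ?M \<phi>" by (rule integrable_continuous_ivl[OF c\<phi>])
    define J where "J = (\<integral>s. \<phi> s \<partial>?M)"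
    define \<theta> where "\<theta> s = \<phi> s - J / I * \<rho> s" for s
    obtain a b where ab: "0 < a" "a < b" "b < L" "\<And>s. s \<notin> {a..b} \<Longrightarrow> \<phi> s = 0"
      by (rule test_fun_support[OF \<phi>]) (use L in \<open>force intro: that[of "L/3" "L/2"]\<close>)+
    obtain \<Theta> where \<Theta>: "test_fun L \<Theta>" "deriv \<Theta> = \<theta>"
    proof (rule test_fun_antiderivative[of \<theta> "min a (L/3)" "max b (2*L/3)" L])
      show "continuous_on UNIV \<theta>" unfolding \<theta>_def by (intro continuous_intros c\<phi> c\<rho>)
      show "\<theta> s = 0" if "s \<notin> {min a (L/3)..max b (2*L/3)}" for s
      proof -
        have "s \<notin> {a..b}" "s \<notin> {L/3..2*L/3}" using that by auto
        then show ?thesis using ab(4)[of s] by (auto simp: \<theta>_def \<rho>_def cutoff_def)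
      qed
      show "(\<integral>s. \<theta> s \<partial>?M) = 0"
        using i\<phi> i\<rho> I by (simp add: \<theta>_def J_def[symmetric] I_def[symmetric])
    qed (use ab L in auto)
    have ih\<phi>: "integrable ?M (\<lambda>s. h s * \<phi> s)" by (rule integrable_mult_continuous[OF h c\<phi>])
    have ih\<rho>: "integrable ?M (\<lambda>s. h s * \<rho> s)" by (rule integrable_mult_continuous[OF h c\<rho>])
    have "0 = (\<integral>s. h s * \<theta> s \<partial>?M)" using orth[OF \<Theta>(1)] \<Theta>(2) by simp
    also have "\<dots> = (\<integral>s. h s * \<phi> s - J / I * (h s * \<rho> s) \<partial>?M)"
      by (simp add: \<theta>_def algebra_simps)
    also have "\<dots> = (\<integral>s. h s * \<phi> s \<partial>?M) - c * J"
      using ih\<phi> ih\<rho> by (simp add: c_def)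
    also have "\<dots> = (\<integral>s. (h s - c) * \<phi> s \<partial>?M)"
      using ih\<phi> i\<phi> by (simp add: algebra_simps J_def)
    finally show "(\<integral>s. (h s - c) * \<phi> s \<partial>?M) = 0" by simp
  qed
  then show thesis using that[of c] by simp
qed

section \<open>Sobolev functions on an interval are primitives\<close>
lemma integral_ivl_below:
  assumes f: "integrable (leb_ivl L) (f::real\<Rightarrow>real)" and t: "t \<in> {0..L}"
  shows "(\<integral>s. (if s < t then f s else 0) \<partial>leb_ivl L) = integral {0..t} f"
proof -
  have eq: "(\<lambda>s. if s < t then f s else 0) = (\<lambda>s. f s * indicat_real {..<t} s)"
    by (auto simp: indicator_def)
  have "integrable (leb_ivl L) (\<lambda>s. f s * indicat_real {..<t} s)"
  proof (rule integrable_mult_bounded[OF f, where B=1])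
    show "indicat_real {..<t} \<in> borel_measurable (leb_ivl L)"
      by (intro measurable_restrict_space1 borel_measurable_indicator) auto
  qed (auto simp: indicator_def)
  then have "(\<integral>s. (if s < t then f s else 0) \<partial>leb_ivl L) = integral {0..L} (\<lambda>s. if s \<in> {..<t} then f s else 0)"
    unfolding eq[symmetric] using integral_ivl_eq by simp
  also have "\<dots> = integral ({..<t} \<inter> {0..L}) f"
    by (rule Henstock_Kurzweil_Integration.integral_restrict_Int)
  also have "\<dots> = integral {0..t} f"
    by (rule integral_spike_set; rule negligible_subset[of "{t}"]) (use t in auto)
  finally show ?thesis .
qed

lemma integral_ivl_above:
  assumes f: "integrable (leb_ivl L) (f::real\<Rightarrow>real)" and t: "t \<in> {0..L}"
  shows "(\<integral>s. (if t < s then f s else 0) \<partial>leb_ivl L) = integral {t..L} f"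
proof -
  have eq: "(\<lambda>s. if t < s then f s else 0) = (\<lambda>s. f s * indicat_real {t<..} s)"
    by (auto simp: indicator_def)
  have "integrable (leb_ivl L) (\<lambda>s. f s * indicat_real {t<..} s)"
  proof (rule integrable_mult_bounded[OF f, where B=1])
    show "indicat_real {t<..} \<in> borel_measurable (leb_ivl L)"
      by (intro measurable_restrict_space1 borel_measurable_indicator) auto
  qed (auto simp: indicator_def)
  then have "(\<integral>s. (if t < s then f s else 0) \<partial>leb_ivl L) = integral {0..L} (\<lambda>s. if s \<in> {t<..} then f s else 0)"
    unfolding eq[symmetric] using integral_ivl_eq by simp
  also have "\<dots> = integral ({t<..} \<inter> {0..L}) f"
    by (rule Henstock_Kurzweil_Integration.integral_restrict_Int)
  also have "\<dots> = integral {t..L} f"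
    by (rule integral_spike_set; rule negligible_subset[of "{t}"]) (use t in auto)
  finally show ?thesis .
qed

lemma continuous_on_primitive:
  "integrable (leb_ivl L) (g::real\<Rightarrow>real) \<Longrightarrow> continuous_on {0..L} (\<lambda>s. C + integral {0..s} g)"
  by (intro continuous_intros indefinite_integral_continuous_1 integrable_on_ivl)

text \<open>
  The density \<open>g\<close> is merely integrable, so the product rule is not available; instead Fubini's
  theorem is applied to \<open>g s * \<phi>' t\<close> on the triangle \<open>s < t\<close>.
\<close>
lemma integral_primitive_by_parts:
  assumes g: "integrable (leb_ivl L) (g::real\<Rightarrow>real)" and \<phi>: "test_fun L \<phi>"
  shows "(\<integral>t. (C + integral {0..t} g) * deriv \<phi> t \<partial>leb_ivl L) = - (\<integral>s. g s * \<phi> s \<partial>leb_ivl L)"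
proof -
  let ?M = "leb_ivl L"
  interpret M: finite_measure ?M by (rule finite_measure_ivl)
  interpret P: pair_sigma_finite ?M ?M ..
  let ?d = "deriv \<phi>"
  have cd: "continuous_on S ?d" for S by (rule test_fun_deriv[OF \<phi>])
  have id: "integrable ?M ?d" by (rule integrable_continuous_ivl[OF cd])
  have [measurable]: "g \<in> borel_measurable ?M" "?d \<in> borel_measurable ?M" using g id by auto
  have [measurable]: "(\<lambda>s. s) \<in> borel_measurable ?M"
    using id_borel_measurable_lebesgue_on[of "{0<..<L}"] by (simp add: id_def)
  have G: "integrable (?M \<Otimes>\<^sub>M ?M) (\<lambda>(s,t). g s * ?d t)"
  proof (rule P.Fubini_integrable)
    show "(\<lambda>(s,t). g s * ?d t) \<in> borel_measurable (?M \<Otimes>\<^sub>M ?M)" by measurable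
    have "integrable ?M (\<lambda>s. \<bar>g s\<bar> * (\<integral>t. \<bar>?d t\<bar> \<partial>?M))" using g by simp
    then show "integrable ?M (\<lambda>s. \<integral>t. norm (case (s, t) of (s, t) \<Rightarrow> g s * ?d t) \<partial>?M)"
      by (simp add: abs_mult)
    show "AE s in ?M. integrable ?M (\<lambda>t. case (s, t) of (s, t) \<Rightarrow> g s * ?d t)"
      using id by simp
  qed
  have "integrable (?M \<Otimes>\<^sub>M ?M) (\<lambda>(s,t). if s < t then g s * ?d t else 0)"
    by (rule Bochner_Integration.integrable_bound[OF G]) (measurable, auto)
  from P.Fubini_integral[OF this]
  have F: "(\<integral>t. (\<integral>s. (if s < t then g s * ?d t else 0) \<partial>?M) \<partial>?M)
    = (\<integral>s. (\<integral>t. (if s < t then g s * ?d t else 0) \<partial>?M) \<partial>?M)" .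
  have FTC: "(?d has_integral (\<phi> L - \<phi> s)) {s..L}" if "s \<le> L" for s
    using that test_fun_deriv(1)[OF \<phi>] by (intro fundamental_theorem_of_calculus)
      (auto simp: has_real_derivative_iff_has_vector_derivative intro: has_vector_derivative_at_within)
  have l: "(\<integral>s. (if s < t then g s * ?d t else 0) \<partial>?M) = integral {0..t} g * ?d t" if "t \<in> space ?M" for t
  proof -
    have "(\<integral>s. (if s < t then g s * ?d t else 0) \<partial>?M) = (\<integral>s. (if s < t then g s else 0) * ?d t \<partial>?M)"
      by (rule Bochner_Integration.integral_cong) auto
    then show ?thesis using integral_ivl_below[OF g, of t] that by simp
  qed
  have r: "(\<integral>t. (if s < t then g s * ?d t else 0) \<partial>?M) = - (g s * \<phi> s)" if "s \<in> space ?M" for s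
  proof -
    have "(\<integral>t. (if s < t then g s * ?d t else 0) \<partial>?M) = (\<integral>t. g s * (if s < t then ?d t else 0) \<partial>?M)"
      by (rule Bochner_Integration.integral_cong) auto
    then show ?thesis using integral_ivl_above[OF id, of s] that integral_unique[OF FTC[of s]] 
        test_fun_zero_right[OF \<phi>, of L] by simp
  qed
  have "(\<integral>t. integral {0..t} g * ?d t \<partial>?M) = - (\<integral>s. g s * \<phi> s \<partial>?M)"
  proof -
    have "(\<integral>t. integral {0..t} g * ?d t \<partial>?M) = (\<integral>t. (\<integral>s. (if s < t then g s * ?d t else 0) \<partial>?M) \<partial>?M)"
      by (rule Bochner_Integration.integral_cong[OF refl l[symmetric]])
    also have "\<dots> = (\<integral>s. - (g s * \<phi> s) \<partial>?M)"
      unfolding F by (rule Bochner_Integration.integral_cong[OF refl r])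
    finally show ?thesis by simp
  qed
  moreover have "integrable ?M (\<lambda>t. ?d t * integral {0..t} g)"
    using integrable_mult_continuous[OF id continuous_on_primitive[OF g, of 0]] by simp
  moreover have "(\<integral>t. C * ?d t \<partial>?M) = 0"
  proof (cases "0 \<le> L")
    case True
    then show ?thesis using integral_ivl_eq[OF id] integral_unique[OF FTC[of 0]]
      test_fun_zero_right[OF \<phi>, of L] test_fun_zero_left[OF \<phi>, of 0] by simp
  next
    case False
    then show ?thesis by simp
  qed
  ultimately show ?thesis using id by (simp add: algebra_simps)
qed

lemma has_weak_deriv_primitive:
  assumes g: "g \<in> L2_interval L" and f: "\<And>s. s \<in> {0<..<L} \<Longrightarrow> f s = C + integral {0..s} g"
  shows "has_weak_deriv L f g" "f \<in> W12_interval L"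
proof -
  have ig: "integrable (leb_ivl L) g" using g by (rule L2_imp_integrable)
  have "(\<integral>s. f s * deriv \<phi> s \<partial>leb_ivl L) = - (\<integral>s. g s * \<phi> s \<partial>leb_ivl L)" if "test_fun L \<phi>" for \<phi>
    using integral_primitive_by_parts[OF ig that, of C] f
    by (subst Bochner_Integration.integral_cong[OF refl, of _ _ "\<lambda>s. (C + integral {0..s} g) * deriv \<phi> s"]) auto
  then show wd: "has_weak_deriv L f g" using g by (simp add: has_weak_deriv_def)
  have "(\<lambda>s. C + integral {0..s} g) \<in> L2_interval L"
    by (rule continuous_imp_L2[OF continuous_on_primitive[OF ig]])
  then have "f \<in> L2_interval L" using f unfolding L2_interval_def mem_Collect_eq
    by (elim conj_forward; subst measurable_cong Bochner_Integration.integrable_cong[OF refl]) auto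
  then show "f \<in> W12_interval L" using wd by (auto simp: W12_interval_def)
qed

text \<open>
  The derivative chosen by \<open>weak_deriv\<close> is an arbitrary representative; this lemma is what allows it
  to be computed.
\<close>
lemma has_weak_deriv_unique:
  assumes "has_weak_deriv L f g" "has_weak_deriv L f g'"
  shows "AE s in leb_ivl L. g s = g' s"
proof -
  have i: "integrable (leb_ivl L) g" "integrable (leb_ivl L) g'"
    using assms by (auto simp: has_weak_deriv_def intro: L2_imp_integrable)
  have "AE s in leb_ivl L. g s - g' s = 0"
  proof (rule AE_zero_if_orthogonal_to_test_fun)
    show "integrable (leb_ivl L) (\<lambda>s. g s - g' s)" using i by simp
    fix \<phi> assume \<phi>: "test_fun L \<phi>"
    have "(\<integral>s. g s * \<phi> s \<partial>leb_ivl L) = (\<integral>s. g' s * \<phi> s \<partial>leb_ivl L)"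
      using assms \<phi> by (simp add: has_weak_deriv_def)
    then show "(\<integral>s. (g s - g' s) * \<phi> s \<partial>leb_ivl L) = 0"
      using integrable_mult_continuous[OF i(1) test_fun_deriv(3)[OF \<phi>]]
        integrable_mult_continuous[OF i(2) test_fun_deriv(3)[OF \<phi>]]
      by (simp add: left_diff_distrib)
  qed
  then show ?thesis by simp
qed

lemma has_weak_deriv_weak_deriv:
  "f \<in> W12_interval L \<Longrightarrow> has_weak_deriv L f (weak_deriv L f)"
  unfolding W12_interval_def weak_deriv_def using someI_ex[of "has_weak_deriv L f"] by auto

lemma weak_deriv_L2: "f \<in> W12_interval L \<Longrightarrow> weak_deriv L f \<in> L2_interval L"
  using has_weak_deriv_weak_deriv by (auto simp: has_weak_deriv_def)

lemma weak_deriv_primitive: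
  assumes g: "g \<in> L2_interval L" and f: "\<And>s. s \<in> {0<..<L} \<Longrightarrow> f s = C + integral {0..s} g"
  shows "AE s in leb_ivl L. weak_deriv L f s = g s"
  using has_weak_deriv_primitive[OF assms] has_weak_deriv_unique has_weak_deriv_weak_deriv by blast

text \<open>
  The function and the primitive of its weak derivative have the same weak derivative, so their
  difference is orthogonal to all derivatives of test functions.
\<close>
lemma W12_interval_primitive:
  assumes L: "0 < L" and f: "f \<in> W12_interval L"
  obtains C where "AE s in leb_ivl L. f s = C + integral {0..s} (weak_deriv L f)"
proof -
  let ?g = "weak_deriv L f"
  have wd: "has_weak_deriv L f ?g" by (rule has_weak_deriv_weak_deriv[OF f])
  have ig: "integrable (leb_ivl L) ?g" by (rule L2_imp_integrable[OF weak_deriv_L2[OF f]])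
  have if': "integrable (leb_ivl L) f" using f by (auto simp: W12_interval_def intro: L2_imp_integrable)
  have ip: "integrable (leb_ivl L) (\<lambda>s. 0 + integral {0..s} ?g)"
    by (rule integrable_continuous_ivl[OF continuous_on_primitive[OF ig]])
  obtain C where "AE s in leb_ivl L. f s - (0 + integral {0..s} ?g) = C"
  proof (rule du_Bois_Reymond[OF L])
    show "integrable (leb_ivl L) (\<lambda>s. f s - (0 + integral {0..s} ?g))" using if' ip by simp
    fix \<phi> assume \<phi>: "test_fun L \<phi>"
    show "(\<integral>s. (f s - (0 + integral {0..s} ?g)) * deriv \<phi> s \<partial>leb_ivl L) = 0"
      using integrable_mult_continuous[OF if' test_fun_deriv(2)[OF \<phi>]]
        integrable_mult_continuous[OF ip test_fun_deriv(2)[OF \<phi>]]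
        integral_primitive_by_parts[OF ig \<phi>, of 0] wd \<phi>
      by (simp add: left_diff_distrib has_weak_deriv_def)
  qed
  then show thesis by (intro that[of C]) (auto elim: lebesgue_on_mono)
qed

lemma primitive_cong_AE:
  assumes "AE s in leb_ivl L. g s = h s" and "t \<in> {0..L}"
  shows "integral {0..t} g = integral {0..t} (h :: real \<Rightarrow> real)"
proof -
  have "AE s in lebesgue. s \<in> {0<..<L} \<longrightarrow> g s = h s"
    using assms(1) by (subst (asm) AE_restrict_space_iff) auto
  then have "negligible {s. \<not> (s \<in> {0<..<L} \<longrightarrow> g s = h s)}"
    by (simp add: negligible_iff_null_sets completion.AE_iff_null_sets)
  then have "negligible ({s. \<not> (s \<in> {0<..<L} \<longrightarrow> g s = h s)} \<union> {0, L})" by simp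
  then show ?thesis
    by (rule integral_spike) (use assms(2) in auto)
qed

text \<open>
  The continuous representative of a class is unique, which makes its one-sided limits, the
  traces, well defined: two such functions differ on an open set, and a nonempty open set is not
  negligible.
\<close>
lemma AE_eq_continuous_imp_eq:
  assumes "continuous_on {0<..<L} f" "continuous_on {0<..<L} g"
    and "AE s in leb_ivl L. f s = (g s :: real)" "s \<in> {0<..<L}"
  shows "f s = g s"
proof (rule ccontr)
  let ?U = "{s \<in> {0<..<L}. f s - g s \<noteq> 0}"
  assume "f s \<noteq> g s"
  have "?U = {0<..<L} \<inter> (\<lambda>s. f s - g s) -` (-{0})" by auto
  also have "open \<dots>" 
    by (rule continuous_open_preimage) (auto intro!: continuous_intros assms)
  finally have o: "open ?U" .
  have "AE s in lebesgue. s \<in> {0<..<L} \<longrightarrow> f s = g s"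
    using assms(3) by (subst (asm) AE_restrict_space_iff) auto
  then have "AE s in lebesgue. s \<notin> ?U" by (rule AE_mp) auto
  then have "negligible ?U" 
    using o by (simp add: negligible_iff_null_sets AE_iff_null_sets borel_open[THEN sets_completionI_sets[of _ lborel, simplified]])
  then show False using open_not_negligible[OF o] \<open>f s \<noteq> g s\<close> assms(4) by auto
qed

section \<open>The stationary equation on one edge\<close>

text \<open>
  With \<open>\<beta> = b / \<mu>\<close>, the equation \<open>m' + \<beta> m = c\<close> has the integrating factor
  \<open>exp (potential \<beta>)\<close>.  In the theory of one-dimensional diffusions the integral of this factor
  is called the scale function.
\<close>
definition potential :: "(real \<Rightarrow> real) \<Rightarrow> real \<Rightarrow> real" where
  "potential \<beta> s = integral {0..s} \<beta>"

definition scale_fun :: "(real \<Rightarrow> real) \<Rightarrow> real \<Rightarrow> real" where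
  "scale_fun \<beta> s = integral {0..s} (\<lambda>r. exp (potential \<beta> r))"

text \<open>The solution of \<open>m' + \<beta> m = c\<close> with \<open>m 0 = a\<close>.\<close>
definition profile :: "(real \<Rightarrow> real) \<Rightarrow> real \<Rightarrow> real \<Rightarrow> real \<Rightarrow> real" where
  "profile \<beta> a c s = exp (- potential \<beta> s) * (a + c * scale_fun \<beta> s)"

lemma potential_0 [simp]: "potential \<beta> 0 = 0"
  by (simp add: potential_def)
lemma scale_fun_0 [simp]: "scale_fun \<beta> 0 = 0"
  by (simp add: scale_fun_def)
lemma profile_0 [simp]: "profile \<beta> a c 0 = a"
  by (simp add: profile_def)

lemma profile_scale: "profile \<beta> (k * a) (k * c) s = k * profile \<beta> a c s"
  by (simp add: profile_def algebra_simps)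

context
  fixes L :: real and \<beta> :: "real \<Rightarrow> real"
  assumes L: "0 < L" and \<beta>: "continuous_on {0..L} \<beta>"
begin

lemma potential_deriv:
  "s \<in> {0..L} \<Longrightarrow> (potential \<beta> has_real_derivative \<beta> s) (at s within {0..L})"
  using integral_has_vector_derivative[OF \<beta>, of s]
  by (simp add: has_real_derivative_iff_has_vector_derivative potential_def[abs_def])

lemma continuous_potential: "continuous_on {0..L} (potential \<beta>)"
  by (rule DERIV_continuous_on) (rule potential_deriv)

lemma scale_fun_deriv:
  "s \<in> {0..L} \<Longrightarrow> (scale_fun \<beta> has_real_derivative exp (potential \<beta> s)) (at s within {0..L})"
  using integral_has_vector_derivative[of 0 L "\<lambda>r. exp (potential \<beta> r)" s] continuous_potential
  by (simp add: has_real_derivative_iff_has_vector_derivative scale_fun_def[abs_def] continuous_intros)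

lemma scale_fun_mono: "0 \<le> s \<Longrightarrow> s \<le> t \<Longrightarrow> t \<le> L \<Longrightarrow> scale_fun \<beta> s \<le> scale_fun \<beta> t"
  unfolding scale_fun_def
  by (intro integral_subset_le integrable_continuous_real continuous_intros
      continuous_on_subset[OF continuous_potential]) auto

lemma scale_fun_pos: "0 < scale_fun \<beta> L"
proof -
  have c: "continuous_on {0..L} (\<lambda>r. exp (potential \<beta> r))"
    by (intro continuous_intros continuous_potential)
  have "scale_fun \<beta> L \<noteq> 0"
    unfolding scale_fun_def using integral_eq_0_iff[OF c] L by auto
  moreover have "0 \<le> scale_fun \<beta> L" using scale_fun_mono[of 0 L] L by simp
  ultimately show ?thesis by simp
qed

lemma profile_deriv:
  assumes "s \<in> {0..L}"
  shows "(profile \<beta> a c has_real_derivative c - \<beta> s * profile \<beta> a c s) (at s within {0..L})"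
proof -
  have "exp (potential \<beta> s) * exp (- potential \<beta> s) = 1" by (simp add: exp_minus)
  then show ?thesis
    unfolding profile_def[abs_def]
    by (auto intro!: derivative_eq_intros potential_deriv scale_fun_deriv assms simp: algebra_simps)
qed

lemma continuous_profile: "continuous_on {0..L} (profile \<beta> a c)"
  by (rule DERIV_continuous_on) (rule profile_deriv)

lemma profile_eq_integral:
  assumes s: "s \<in> {0..L}"
  shows "profile \<beta> a c s = a + integral {0..s} (\<lambda>r. c - \<beta> r * profile \<beta> a c r)"
proof -
  have "((\<lambda>r. c - \<beta> r * profile \<beta> a c r) has_integral (profile \<beta> a c s - profile \<beta> a c 0)) {0..s}"
  proof (rule fundamental_theorem_of_calculus)
    fix r assume "r \<in> {0..s}"
    then show "(profile \<beta> a c has_vector_derivative c - \<beta> r * profile \<beta> a c r) (at r within {0..s})"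
      unfolding has_real_derivative_iff_has_vector_derivative[symmetric]
      using s by (intro DERIV_subset[OF profile_deriv]) auto
  qed (use s in auto)
  then show ?thesis by (simp add: integral_unique)
qed

lemma slope_from_end_value: "c = (exp (potential \<beta> L) * profile \<beta> a c L - a) / scale_fun \<beta> L"
proof -
  have "exp (potential \<beta> L) * exp (- potential \<beta> L) = 1" by (simp add: exp_minus)
  then show ?thesis using scale_fun_pos by (simp add: profile_def field_simps exp_minus)
qed

lemma profile_end:
  "c = (exp (potential \<beta> L) * d - a) / scale_fun \<beta> L \<Longrightarrow> profile \<beta> a c L = d"
  using scale_fun_pos by (simp add: profile_def exp_minus field_simps)

text \<open>
  Up to the factor \<open>exp (potential \<beta>)\<close>, a profile is an affine function of the increasing scale
  function, hence positive as soon as its end values are.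
\<close>
lemma profile_pos:
  assumes a: "0 < a" and d: "0 < profile \<beta> a c L" and s: "s \<in> {0..L}"
  shows "0 < profile \<beta> a c s"
proof -
  let ?\<Phi> = "scale_fun \<beta>" and ?d = "a + c * scale_fun \<beta> L"
  have d': "0 < ?d" using d by (simp add: profile_def zero_less_mult_iff)
  have \<Phi>: "0 \<le> ?\<Phi> s" "?\<Phi> s \<le> ?\<Phi> L" "0 < ?\<Phi> L"
    using scale_fun_mono[of 0 s] scale_fun_mono[of s L] scale_fun_pos s by auto
  have eq: "?\<Phi> L * (a + c * ?\<Phi> s) = a * (?\<Phi> L - ?\<Phi> s) + ?d * ?\<Phi> s"
    by (simp add: algebra_simps)
  have "0 < a * (?\<Phi> L - ?\<Phi> s) + ?d * ?\<Phi> s"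
  proof (cases "?\<Phi> s = 0")
    case True then show ?thesis using a \<Phi> by simp
  next
    case False then show ?thesis using a d' \<Phi> by (intro add_nonneg_pos) auto
  qed
  then have "0 < a + c * ?\<Phi> s" using \<Phi>(3) eq by (metis zero_less_mult_pos)
  then show ?thesis by (simp add: profile_def)
qed

text \<open>
  The equation is assumed only almost everywhere, but its right-hand side is continuous, so \<open>F\<close> is
  in fact continuously differentiable and the integrating factor applies.
\<close>
lemma profile_unique:
  assumes g: "integrable (leb_ivl L) g"
    and F: "\<And>s. s \<in> {0..L} \<Longrightarrow> F s = a + integral {0..s} g"
    and eq: "AE s in leb_ivl L. g s = c - \<beta> s * F s"
    and s: "s \<in> {0..L}"
  shows "F s = profile \<beta> a c s"
proof -
  have cF: "continuous_on {0..L} F"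
    using continuous_on_eq[OF continuous_on_primitive[OF g, of a]] F by metis
  have ch: "continuous_on {0..L} (\<lambda>r. c - \<beta> r * F r)" by (intro continuous_intros \<beta> cF)
  have dF: "(F has_real_derivative c - \<beta> r * F r) (at r within {0..L})" if r: "r \<in> {0..L}" for r
  proof -
    have "((\<lambda>t. a + integral {0..t} (\<lambda>r. c - \<beta> r * F r)) has_real_derivative c - \<beta> r * F r) (at r within {0..L})"
      using integral_has_vector_derivative[OF ch r]
      by (auto simp: has_real_derivative_iff_has_vector_derivative[symmetric] intro!: derivative_eq_intros)
    then show ?thesis
      by (rule has_field_derivative_transform_within[where d=1]) (use r F primitive_cong_AE[OF eq] in auto)
  qed
  \<comment> \<open>The difference of two solutions, multiplied by the integrating factor, is constant.\<close>
  define D where "D r = exp (potential \<beta> r) * (F r - profile \<beta> a c r)" for r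
  have "(D has_real_derivative 0) (at r within {0..L})" if r: "r \<in> {0..L}" for r
    unfolding D_def[abs_def]
    by (auto intro!: derivative_eq_intros potential_deriv dF profile_deriv r simp: algebra_simps)
  then have "\<exists>k. \<forall>r\<in>{0..L}. D r = k"
    by (intro has_field_derivative_zero_constant) auto
  then have "D s = D 0" using s L by auto
  then show ?thesis using F[of 0] L by (simp add: D_def)
qed

end

lemma continuous_extension_closed_interval:
  fixes f :: "real \<Rightarrow> real"
  assumes L: "0 < L" and f: "continuous_on {0<..<L} f"
    and l: "(f \<longlongrightarrow> l) (at_right 0)" and r: "(f \<longlongrightarrow> r) (at_left L)"
  obtains h where "continuous_on {0..L} h" "\<And>s. s \<in> {0<..<L} \<Longrightarrow> h s = f s"
proof -
  define h where "h s = (if s \<le> 0 then l else if s \<ge> L then r else f s)" for s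
  have hf: "h s = f s" if "s \<in> {0<..<L}" for s using that by (auto simp: h_def)
  have "continuous_on {0..L} h"
  proof (rule continuous_on_IccI)
    have "\<forall>\<^sub>F s in at_right 0. f s = h s"
      using L by (auto simp: eventually_at_right h_def intro!: exI[of _ L])
    then show "(h \<longlongrightarrow> h 0) (at_right 0)" using Lim_transform_eventually[OF l] by (simp add: h_def)
  next
    have "\<forall>\<^sub>F s in at_left L. f s = h s"
      using L by (auto simp: eventually_at_left h_def intro!: exI[of _ 0])
    then show "(h \<longlongrightarrow> h L) (at_left L)" using Lim_transform_eventually[OF r] L by (simp add: h_def)
  next
    fix s assume s: "0 < s" "s < L"
    have "continuous_on {0<..<L} h" using continuous_on_eq[OF f] hf by metis
    then show "h \<midarrow>s\<rightarrow> h s" using s 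
      by (metis continuous_on_eq_continuous_at greaterThanLessThan_iff isContD open_greaterThanLessThan)
  qed (rule L)
  then show thesis using hf by (rule that)
qed

section \<open>Balanced vertex values on a connected graph\<close>

text \<open>
  Gaussian elimination: an equation with a nonzero coefficient is used to eliminate one unknown
  from the others.
\<close>
lemma homogeneous_system_nontrivial_solution:
  fixes a :: "'e \<Rightarrow> 'v \<Rightarrow> real"
  assumes "finite E" "finite V" "card E < card V"
  shows "\<exists>x. (\<exists>v\<in>V. x v \<noteq> 0) \<and> (\<forall>e\<in>E. (\<Sum>v\<in>V. a e v * x v) = 0)"
  using assms
proof (induction E arbitrary: V a rule: finite_induct)
  case empty
  then obtain v where "v \<in> V" by fastforce
  then show ?case by (intro exI[of _ "\<lambda>_. 1"]) auto
next
  case (insert e E)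
  show ?case
  proof (cases "\<forall>v\<in>V. a e v = 0")
    case True
    have "card E < card V" using insert by simp
    from insert.IH[OF insert.prems(1) this, of a] True show ?thesis by auto
  next
    case False
    then obtain w where w: "w \<in> V" "a e w \<noteq> 0" by auto
    let ?W = "V - {w}"
    have cW: "card E < card ?W" using insert w by simp
    have fW: "finite ?W" using insert by simp
    \<comment> \<open>The equation \<open>e\<close> expresses the unknown \<open>w\<close> through the others.\<close>
    obtain x where x: "\<exists>v\<in>?W. x v \<noteq> 0"
      "\<And>f. f \<in> E \<Longrightarrow> (\<Sum>v\<in>?W. (a f v - a f w / a e w * a e v) * x v) = 0"
      using insert.IH[OF fW cW, of "\<lambda>f v. a f v - a f w / a e w * a e v"] by auto
    define S where "S f = (\<Sum>v\<in>?W. a f v * x v)" for f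
    define y where "y = x(w := - S e / a e w)"
    have sum: "(\<Sum>v\<in>V. a f v * y v) = a f w * y w + S f" for f
    proof -
      have "(\<Sum>v\<in>V. a f v * y v) = a f w * y w + (\<Sum>v\<in>?W. a f v * y v)"
        using insert.prems(1) w(1) by (rule sum.remove)
      also have "(\<Sum>v\<in>?W. a f v * y v) = S f" unfolding S_def by (rule sum.cong) (auto simp: y_def)
      finally show ?thesis .
    qed
    have "(\<Sum>v\<in>V. a f v * y v) = 0" if "f \<in> E" for f
    proof -
      have "0 = S f - a f w / a e w * S e"
        using x(2)[OF that] by (simp add: S_def algebra_simps sum_subtractf sum_distrib_left)
      then show ?thesis unfolding sum by (simp add: y_def)
    qed
    moreover have "(\<Sum>v\<in>V. a e v * y v) = 0" unfolding sum using w by (simp add: y_def)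
    moreover have "\<exists>v\<in>V. y v \<noteq> 0" using x(1) by (auto simp: y_def)
    ultimately show ?thesis by (intro exI[of _ y]) auto
  qed
qed

lemma sum_mult_of_bool:
  assumes "finite V" "u \<in> V"
  shows "(\<Sum>v\<in>V. c v * of_bool (u = v)) = (c u :: real)"
proof -
  have "(\<Sum>v\<in>V. c v * of_bool (u = v)) = (\<Sum>v\<in>V. if u = v then c v else 0)"
    by (rule sum.cong) auto
  also have "\<dots> = c u" using assms by simp
  finally show ?thesis .
qed

text \<open>
  The transition rates of a Markov chain: along the edge \<open>e\<close>, mass flows from \<open>t e\<close> to \<open>s e\<close> at
  rate \<open>p e\<close> and back at rate \<open>q e\<close>.  Connectedness is stated through vertex sets that no edge
  leaves, which is the form in which it is used.
\<close>
locale exchange_network =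
  fixes V :: "'v set" and E :: "'e set" and s t :: "'e \<Rightarrow> 'v" and p q :: "'e \<Rightarrow> real"
  assumes finite_V: "finite V" and V_nonempty: "V \<noteq> {}" and finite_E: "finite E"
    and s_in: "\<And>e. e \<in> E \<Longrightarrow> s e \<in> V" and t_in: "\<And>e. e \<in> E \<Longrightarrow> t e \<in> V"
    and p_pos: "\<And>e. e \<in> E \<Longrightarrow> p e > 0" and q_pos: "\<And>e. e \<in> E \<Longrightarrow> q e > 0"
    and connected: "\<And>S. S \<subseteq> V \<Longrightarrow> S \<noteq> {} \<Longrightarrow> (\<And>e. e \<in> E \<Longrightarrow> s e \<in> S \<longleftrightarrow> t e \<in> S) \<Longrightarrow> S = V"
begin

definition flux :: "('v \<Rightarrow> real) \<Rightarrow> 'e \<Rightarrow> real" where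
  "flux T e = p e * T (t e) - q e * T (s e)"

text \<open>
  Kirchhoff's law in weak form.  With \<open>\<psi>\<close> the indicator of a vertex it says that the fluxes
  at that vertex add up to zero.
\<close>
definition balanced :: "('v \<Rightarrow> real) \<Rightarrow> bool" where
  "balanced T \<longleftrightarrow> (\<forall>\<psi>. (\<Sum>e\<in>E. flux T e * (\<psi> (t e) - \<psi> (s e))) = 0)"

text \<open>
  Since the rates are positive, \<open>flux T e\<close> has the sign of \<open>sgn (T (t e)) - sgn (T (s e))\<close>
  whenever the latter is nonzero.  Testing with \<open>sgn T\<close> therefore gives a vanishing sum of
  nonnegative terms.
\<close>
lemma balanced_sgn:
  assumes "balanced T" "v \<in> V" "w \<in> V"
  shows "sgn (T v) = sgn (T w)"
proof -
  let ?f = "\<lambda>e. flux T e * (sgn (T (t e)) - sgn (T (s e)))"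
  have nn: "?f e \<ge> 0" and eq: "?f e = 0 \<Longrightarrow> sgn (T (t e)) = sgn (T (s e))" if "e \<in> E" for e
  proof -
    have "p e > 0" "q e > 0" using p_pos q_pos that by auto
    then have *: "sgn (p e * T (t e)) = sgn (T (t e))" "sgn (q e * T (s e)) = sgn (T (s e))"
      by (auto simp: sgn_mult)
    show "?f e \<ge> 0" "?f e = 0 \<Longrightarrow> sgn (T (t e)) = sgn (T (s e))"
      unfolding flux_def using * by (auto simp: sgn_if split: if_splits)
  qed
  have "(\<Sum>e\<in>E. ?f e) = 0"
    using assms(1)[unfolded balanced_def, THEN spec, of "\<lambda>v. sgn (T v)"] .
  then have "\<forall>e\<in>E. ?f e = 0" using nn finite_E by (subst (asm) sum_nonneg_eq_0_iff) auto
  then have c: "sgn (T (t e)) = sgn (T (s e))" if "e \<in> E" for e using eq that by blast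
  have "{x\<in>V. sgn (T x) = sgn (T w)} = V"
    using assms(3) c s_in t_in by (intro connected) auto
  then show ?thesis using assms(2) by auto
qed

lemma balanced_linear: "balanced T \<Longrightarrow> balanced T' \<Longrightarrow> balanced (\<lambda>v. a * T v + b * T' v)"
proof -
  assume a: "balanced T" "balanced T'"
  have "flux (\<lambda>v. a * T v + b * T' v) e = a * flux T e + b * flux T' e" for e
    by (simp add: flux_def algebra_simps)
  then show ?thesis using a unfolding balanced_def
    by (simp add: distrib_right sum.distrib sum_distrib_left[symmetric] mult.assoc)
qed

text \<open>
  A suitable combination of \<open>T\<close> and \<open>T'\<close> vanishes at one vertex, hence has sign zero
  everywhere.
\<close>
lemma balanced_proportional:
  assumes "balanced T" "balanced T'" "\<And>v. v \<in> V \<Longrightarrow> T v > 0"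
  obtains k where "\<And>v. v \<in> V \<Longrightarrow> T' v = k * T v"
proof -
  obtain w where w: "w \<in> V" using V_nonempty by auto
  define k where "k = T' w / T w"
  have b: "balanced (\<lambda>v. 1 * T' v + (-k) * T v)" by (rule balanced_linear) fact+
  have "T' v = k * T v" if "v \<in> V" for v
    using balanced_sgn[OF b that w] assms(3)[OF w] by (simp add: k_def sgn_0_0)
  then show thesis by (rule that)
qed

text \<open>
  Only differences of \<open>\<psi>\<close> enter the balance, so \<open>\<psi>\<close> may be shifted to vanish at \<open>w\<close> and then
  expanded into indicators of the other vertices.
\<close>
lemma balanced_if_balanced_except_one:
  assumes w: "w \<in> V"
    and "\<And>v. v \<in> V - {w} \<Longrightarrow> (\<Sum>e\<in>E. flux T e * (of_bool (t e = v) - of_bool (s e = v))) = 0"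
  shows "balanced T"
  unfolding balanced_def
proof
  fix \<psi> :: "'v \<Rightarrow> real"
  have "\<psi> (t e) - \<psi> (s e) = (\<Sum>v\<in>V-{w}. (\<psi> v - \<psi> w) * (of_bool (t e = v) - of_bool (s e = v)))"
    if "e \<in> E" for e
  proof -
    have *: "(\<Sum>v\<in>V-{w}. (\<psi> v - \<psi> w) * of_bool (u = v)) = \<psi> u - \<psi> w" if "u \<in> V" for u
      using finite_V that by (cases "u = w") (auto simp: of_bool_def if_distrib cong: if_cong)
    show ?thesis using *[OF s_in[OF that]] *[OF t_in[OF that]]
      by (simp add: right_diff_distrib sum_subtractf)
  qed
  then have "(\<Sum>e\<in>E. flux T e * (\<psi> (t e) - \<psi> (s e))) = 
    (\<Sum>e\<in>E. \<Sum>v\<in>V-{w}. (\<psi> v - \<psi> w) * (flux T e * (of_bool (t e = v) - of_bool (s e = v))))"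
    by (simp add: sum_distrib_left mult_ac)
  also have "\<dots> = (\<Sum>v\<in>V-{w}. (\<psi> v - \<psi> w) * (\<Sum>e\<in>E. flux T e * (of_bool (t e = v) - of_bool (s e = v))))"
    by (subst sum.swap) (simp add: sum_distrib_left)
  also have "\<dots> = 0" using assms(2) by simp
  finally show "(\<Sum>e\<in>E. flux T e * (\<psi> (t e) - \<psi> (s e))) = 0" .
qed

text \<open>
  Dropping the equation of one vertex leaves fewer equations than unknowns; the nonzero solution
  has constant sign and is made positive by multiplication with that sign.
\<close>
lemma ex_positive_balanced:
  obtains T where "balanced T" "\<And>v. v \<in> V \<Longrightarrow> T v > 0"
proof -
  obtain w where w: "w \<in> V" using V_nonempty by auto
  define a where "a v u = (\<Sum>e\<in>E. (p e * of_bool (t e = u) - q e * of_bool (s e = u)) *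
      (of_bool (t e = v) - of_bool (s e = v)))" for v u
  obtain T where T: "\<exists>v\<in>V. T v \<noteq> 0" "\<And>v. v \<in> V - {w} \<Longrightarrow> (\<Sum>u\<in>V. a v u * T u) = 0"
  proof -
    have "card (V - {w}) < card V" using finite_V w by (metis card_Diff1_less)
    then show thesis
      using homogeneous_system_nontrivial_solution[of "V - {w}" V a] finite_V that by auto
  qed
  have fl: "flux T e = (\<Sum>u\<in>V. (p e * of_bool (t e = u) - q e * of_bool (s e = u)) * T u)" if "e \<in> E" for e
  proof -
    have "(\<Sum>u\<in>V. (p e * of_bool (t e = u) - q e * of_bool (s e = u)) * T u)
      = (\<Sum>u\<in>V. p e * T u * of_bool (t e = u)) - (\<Sum>u\<in>V. q e * T u * of_bool (s e = u))"
      unfolding sum_subtractf[symmetric] by (rule sum.cong) (simp_all add: algebra_simps)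
    then show ?thesis
      using sum_mult_of_bool[OF finite_V s_in[OF that], of "\<lambda>u. q e * T u"]
        sum_mult_of_bool[OF finite_V t_in[OF that], of "\<lambda>u. p e * T u"] by (simp add: flux_def)
  qed
  have bal: "balanced T"
  proof (rule balanced_if_balanced_except_one[OF w])
    fix v assume "v \<in> V - {w}"
    have "(\<Sum>e\<in>E. flux T e * (of_bool (t e = v) - of_bool (s e = v))) = (\<Sum>u\<in>V. a v u * T u)"
    proof -
      have "(\<Sum>e\<in>E. flux T e * (of_bool (t e = v) - of_bool (s e = v))) =
        (\<Sum>e\<in>E. \<Sum>u\<in>V. (p e * of_bool (t e = u) - q e * of_bool (s e = u)) *
          (of_bool (t e = v) - of_bool (s e = v)) * T u)"
        by (rule sum.cong[OF refl]) (simp only: fl sum_distrib_right mult.assoc mult.commute[of "T _"])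
      also have "\<dots> = (\<Sum>u\<in>V. a v u * T u)"
        unfolding a_def sum_distrib_right by (rule sum.swap)
      finally show ?thesis .
    qed
    then show "(\<Sum>e\<in>E. flux T e * (of_bool (t e = v) - of_bool (s e = v))) = 0"
      using T(2) \<open>v \<in> V - {w}\<close> by simp
  qed
  obtain v0 where v0: "v0 \<in> V" "T v0 \<noteq> 0" using T(1) by auto
  have "balanced (\<lambda>v. sgn (T v0) * T v + 0 * T v)" by (rule balanced_linear[OF bal bal])
  moreover have "sgn (T v0) * T v > 0" if "v \<in> V" for v
    using balanced_sgn[OF bal that v0(1)] v0(2) by (auto simp: sgn_if split: if_splits)
  ultimately show thesis by (intro that[of "\<lambda>v. sgn (T v0) * T v"]) auto
qed

end

section \<open>Functions on a network\<close>
locale valid_network =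
  fixes N :: "('d::finite, 'i) network"
  assumes network: "is_network N"
begin

lemma
  shows finite_verts: "finite (verts N)" and verts_nonempty: "verts N \<noteq> {}"
    and pairs_subset: "pairs N \<subseteq> verts N \<times> verts N" and pairs_irrefl: "\<forall>v. (v, v) \<notin> pairs N"
    and vertex_in_pair: "\<forall>v\<in>verts N. \<exists>w. (v, w) \<in> pairs N \<or> (w, v) \<in> pairs N"
    and finite_idx: "finite (idx N)"
    and edge_ends_pair: "\<forall>\<alpha>\<in>idx N. (src N \<alpha>, tgt N \<alpha>) \<in> pairs N \<or> (tgt N \<alpha>, src N \<alpha>) \<in> pairs N"
    and edges_pairs: "edge N ` idx N = (\<lambda>(v, w). closed_segment v w) ` pairs N"
    and verts_Int_edge: "\<forall>\<alpha>\<in>idx N. verts N \<inter> edge N \<alpha> = {src N \<alpha>, tgt N \<alpha>}"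
    and edges_Int: "\<forall>\<alpha>\<in>idx N. \<forall>\<beta>\<in>idx N. \<alpha> \<noteq> \<beta> \<longrightarrow>
        (\<forall>v\<in>verts N. v \<in> edge N \<alpha> \<and> v \<in> edge N \<beta> \<longrightarrow> edge N \<alpha> \<inter> edge N \<beta> = {v}) \<and>
        (\<not> (\<exists>v\<in>verts N. v \<in> edge N \<alpha> \<and> v \<in> edge N \<beta>) \<longrightarrow> edge N \<alpha> \<inter> edge N \<beta> = {})"
    and connected_edges: "connected (\<Union>\<alpha>\<in>idx N. edge N \<alpha>)"
  using network unfolding is_network_def by - (elim conjE, assumption)+

lemma idx_pairs: "\<alpha> \<in> idx N \<Longrightarrow> (src N \<alpha>, tgt N \<alpha>) \<in> pairs N \<or> (tgt N \<alpha>, src N \<alpha>) \<in> pairs N"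
  using edge_ends_pair by blast

lemma src_neq_tgt: "\<alpha> \<in> idx N \<Longrightarrow> src N \<alpha> \<noteq> tgt N \<alpha>"
  using idx_pairs pairs_irrefl by metis

lemma edge_length_pos: "\<alpha> \<in> idx N \<Longrightarrow> 0 < edge_length N \<alpha>"
  using src_neq_tgt by (simp add: edge_length_def)

lemma src_in: "\<alpha> \<in> idx N \<Longrightarrow> src N \<alpha> \<in> verts N" and tgt_in: "\<alpha> \<in> idx N \<Longrightarrow> tgt N \<alpha> \<in> verts N"
  using idx_pairs pairs_subset by blast+

lemma verts_on_edge: "\<alpha> \<in> idx N \<Longrightarrow> verts N \<inter> edge N \<alpha> = {src N \<alpha>, tgt N \<alpha>}"
  using verts_Int_edge by blast

lemma edges_at_eq:
  "v \<in> verts N \<Longrightarrow> edges_at N v = {\<alpha> \<in> idx N. v = src N \<alpha> \<or> v = tgt N \<alpha>}"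
  using verts_on_edge unfolding edges_at_def by blast

lemma edge_inter:
  assumes "\<alpha> \<in> idx N" "\<beta> \<in> idx N" "\<alpha> \<noteq> \<beta>" "x \<in> edge N \<alpha>" "x \<in> edge N \<beta>"
  shows "x \<in> verts N" "v \<in> verts N \<Longrightarrow> v \<in> edge N \<alpha> \<Longrightarrow> v \<in> edge N \<beta> \<Longrightarrow> v = x"
proof -
  note E = edges_Int[THEN bspec, OF assms(1), THEN bspec, OF assms(2), THEN mp, OF assms(3)]
  have 1: "edge N \<alpha> \<inter> edge N \<beta> = {v}" if "v \<in> verts N" "v \<in> edge N \<alpha>" "v \<in> edge N \<beta>" for v
    using E[THEN conjunct1, THEN bspec, OF that(1)] that(2,3) by simp
  have x: "x \<in> edge N \<alpha> \<inter> edge N \<beta>" using assms(4,5) by simp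
  then have "\<exists>v\<in>verts N. v \<in> edge N \<alpha> \<and> v \<in> edge N \<beta>" using E[THEN conjunct2] by (metis empty_iff)
  then show "x \<in> verts N" using 1 x by (metis singletonD)
  show "v = x" if "v \<in> verts N" "v \<in> edge N \<alpha>" "v \<in> edge N \<beta>"
    using 1[OF that] x by simp
qed

lemma pair_edge:
  assumes "(v, w) \<in> pairs N"
  obtains \<alpha> where "\<alpha> \<in> idx N" "{src N \<alpha>, tgt N \<alpha>} = {v, w}"
proof -
  have "closed_segment v w \<in> edge N ` idx N" unfolding edges_pairs using assms by force
  have vw: "v \<in> verts N" "w \<in> verts N" using assms pairs_subset by auto
  from \<open>closed_segment v w \<in> _\<close>
  obtain \<alpha> where \<alpha>: "\<alpha> \<in> idx N" "edge N \<alpha> = closed_segment v w" by auto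
  then have "v \<in> {src N \<alpha>, tgt N \<alpha>}" "w \<in> {src N \<alpha>, tgt N \<alpha>}"
    using verts_on_edge[OF \<alpha>(1)] vw by auto
  moreover have "v \<noteq> w" using pairs_irrefl assms by blast
  ultimately show thesis using that[OF \<alpha>(1)] by blast
qed

lemma edges_at_nonempty: 
  assumes "v \<in> verts N" shows "edges_at N v \<noteq> {}"
proof -
  obtain w where "(v, w) \<in> pairs N \<or> (w, v) \<in> pairs N"
    using vertex_in_pair assms by blast
  then obtain \<alpha> where "\<alpha> \<in> idx N" "v \<in> {src N \<alpha>, tgt N \<alpha>}"
  proof
    assume "(v, w) \<in> pairs N"
    then obtain \<alpha> where "\<alpha> \<in> idx N" "{src N \<alpha>, tgt N \<alpha>} = {v, w}" by (rule pair_edge)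
    then show thesis by (intro that) auto
  next
    assume "(w, v) \<in> pairs N"
    then obtain \<alpha> where "\<alpha> \<in> idx N" "{src N \<alpha>, tgt N \<alpha>} = {w, v}" by (rule pair_edge)
    then show thesis by (intro that) auto
  qed
  then show ?thesis using edges_at_eq[OF assms] by auto
qed

lemma ends_in_edge: "src N \<alpha> \<in> edge N \<alpha>" "tgt N \<alpha> \<in> edge N \<alpha>"
  by (simp_all add: edge_def)

text \<open>
  Two edges at a boundary vertex would share their other endpoint too, the unique neighbour, but
  distinct edges meet in at most one point.
\<close>
lemma edge_at_boundary_unique:
  assumes v: "v \<in> boundary_verts N" and \<alpha>: "\<alpha> \<in> edges_at N v" and \<beta>: "\<beta> \<in> edges_at N v"
  shows "\<alpha> = \<beta>"
proof (rule ccontr)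
  assume ne: "\<alpha> \<noteq> \<beta>"
  have vv: "v \<in> verts N" and uniq: "\<And>w w'. w \<in> verts N \<Longrightarrow> w' \<in> verts N \<Longrightarrow>
      (v, w) \<in> pairs N \<or> (w, v) \<in> pairs N \<Longrightarrow> (v, w') \<in> pairs N \<or> (w', v) \<in> pairs N \<Longrightarrow> w = w'"
    using v unfolding boundary_verts_def by blast+
  have other: "\<exists>w\<in>verts N. ((v, w) \<in> pairs N \<or> (w, v) \<in> pairs N) \<and> w \<in> edge N \<delta> \<and> w \<noteq> v"
    if "\<delta> \<in> edges_at N v" for \<delta>
  proof -
    have \<delta>: "\<delta> \<in> idx N" "v = src N \<delta> \<or> v = tgt N \<delta>" using that edges_at_eq[OF vv] by auto
    from this(2) show ?thesis
    proof
      assume "v = src N \<delta>"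
      then show ?thesis using idx_pairs[OF \<delta>(1)] tgt_in[OF \<delta>(1)] src_neq_tgt[OF \<delta>(1)] ends_in_edge(2)[of \<delta>]
        by (intro bexI[of _ "tgt N \<delta>"]) auto
    next
      assume "v = tgt N \<delta>"
      then show ?thesis using idx_pairs[OF \<delta>(1)] src_in[OF \<delta>(1)] src_neq_tgt[OF \<delta>(1)] ends_in_edge(1)[of \<delta>]
        by (intro bexI[of _ "src N \<delta>"]) auto
    qed
  qed
  obtain w where w: "w \<in> verts N" "(v, w) \<in> pairs N \<or> (w, v) \<in> pairs N" "w \<in> edge N \<alpha>" "w \<noteq> v"
    using other[OF \<alpha>] by blast
  obtain w' where w': "w' \<in> verts N" "(v, w') \<in> pairs N \<or> (w', v) \<in> pairs N" "w' \<in> edge N \<beta>"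
    using other[OF \<beta>] by blast
  have "w = w'" using uniq w w' by blast
  moreover have "\<alpha> \<in> idx N" "\<beta> \<in> idx N" "v \<in> edge N \<alpha>" "v \<in> edge N \<beta>" using \<alpha> \<beta> by (auto simp: edges_at_def)
  ultimately show False using edge_inter(2)[of \<alpha> \<beta> v w] ne w w' by blast
qed

text \<open>
  The edges with endpoints in \<open>S\<close> and the remaining edges cover the network by two closed sets,
  which are disjoint because edges meet only at vertices.
\<close>
lemma closed_under_edges_imp_all:
  assumes S: "S \<subseteq> verts N" "S \<noteq> {}" and cl: "\<And>\<alpha>. \<alpha> \<in> idx N \<Longrightarrow> src N \<alpha> \<in> S \<longleftrightarrow> tgt N \<alpha> \<in> S"
  shows "S = verts N"
proof -
  define A where "A = (\<Union>\<alpha>\<in>{\<alpha>\<in>idx N. src N \<alpha> \<in> S}. edge N \<alpha>)"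
  define B where "B = (\<Union>\<alpha>\<in>{\<alpha>\<in>idx N. src N \<alpha> \<notin> S}. edge N \<alpha>)"
  have ce: "closed (edge N \<alpha>)" for \<alpha> by (simp add: edge_def)
  have closed: "closed A" "closed B"
    unfolding A_def B_def using finite_idx ce by (auto intro!: closed_UN)
  have Un: "(\<Union>\<alpha>\<in>idx N. edge N \<alpha>) = A \<union> B" unfolding A_def B_def by auto
  have disj: "A \<inter> B = {}"
  proof (rule ccontr)
    assume "A \<inter> B \<noteq> {}"
    then obtain x \<alpha> \<beta> where x: "\<alpha> \<in> idx N" "src N \<alpha> \<in> S" "x \<in> edge N \<alpha>"
      "\<beta> \<in> idx N" "src N \<beta> \<notin> S" "x \<in> edge N \<beta>" by (auto simp: A_def B_def)
    then have "x \<in> verts N" using edge_inter(1)[of \<alpha> \<beta> x] by auto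
    then have "x \<in> {src N \<alpha>, tgt N \<alpha>}" "x \<in> {src N \<beta>, tgt N \<beta>}" using x verts_on_edge by blast+
    then show False using cl[of \<alpha>] cl[of \<beta>] x by auto
  qed
  obtain v where v: "v \<in> S" using S by auto
  obtain \<alpha> where \<alpha>: "\<alpha> \<in> edges_at N v" using edges_at_nonempty v S by blast
  then have "\<alpha> \<in> idx N" "src N \<alpha> \<in> S" using edges_at_eq[of v] v S cl[of \<alpha>] by auto
  then have "A \<noteq> {}" using ends_in_edge(1) unfolding A_def by blast
  moreover have "connected (A \<union> B)" using connected_edges unfolding Un .
  ultimately have B: "B = {}" using connected_closedD[of "A \<union> B" A B] closed disj by blast
  have "w \<in> S" if w: "w \<in> verts N" for w
  proof -
    obtain \<beta> where \<beta>: "\<beta> \<in> edges_at N w" using edges_at_nonempty[OF w] by blast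
    then have "\<beta> \<in> idx N" "w = src N \<beta> \<or> w = tgt N \<beta>" using edges_at_eq[OF w] by auto
    moreover have "src N \<beta> \<in> S" using B \<open>\<beta> \<in> idx N\<close> ends_in_edge(1)[of \<beta>] unfolding B_def by blast
    ultimately show ?thesis using cl[of \<beta>] by auto
  qed
  then show ?thesis using S by blast
qed

lemma dist_edge_param: "\<alpha> \<in> idx N \<Longrightarrow> 0 \<le> s \<Longrightarrow> dist (src N \<alpha>) (edge_param N \<alpha> s) = s"
proof -
  assume \<alpha>: "\<alpha> \<in> idx N" and s: "0 \<le> s"
  have "norm (tgt N \<alpha> - src N \<alpha>) = edge_length N \<alpha>"
    unfolding edge_length_def by (subst dist_commute) (rule dist_norm[symmetric])
  then have "norm (s *\<^sub>R ((tgt N \<alpha> - src N \<alpha>) /\<^sub>R edge_length N \<alpha>)) = s"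
    using edge_length_pos[OF \<alpha>] s by simp
  then show ?thesis by (simp add: edge_param_def dist_norm)
qed

lemma edge_param_in_edge:
  assumes "\<alpha> \<in> idx N" "s \<in> {0<..<edge_length N \<alpha>}" shows "edge_param N \<alpha> s \<in> edge N \<alpha>"
proof -
  have "edge_param N \<alpha> s = (1 - s / edge_length N \<alpha>) *\<^sub>R src N \<alpha> + (s / edge_length N \<alpha>) *\<^sub>R tgt N \<alpha>"
    by (simp add: edge_param_def scaleR_left_diff_distrib scaleR_right_diff_distrib divide_inverse mult.commute)
  then show ?thesis using assms unfolding edge_def closed_segment_def
    by (auto intro!: exI[of _ "s / edge_length N \<alpha>"] simp: divide_simps)
qed

lemma edge_param_not_vertex:
  assumes "\<alpha> \<in> idx N" "s \<in> {0<..<edge_length N \<alpha>}" shows "edge_param N \<alpha> s \<notin> verts N"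
proof
  assume "edge_param N \<alpha> s \<in> verts N"
  then have "edge_param N \<alpha> s \<in> {src N \<alpha>, tgt N \<alpha>}"
    using edge_param_in_edge[OF assms] verts_on_edge[OF assms(1)] by blast
  then show False
    using assms dist_edge_param[of \<alpha> s] by (auto simp: edge_length_def[symmetric])
qed

text \<open>
  Assembles functions on the parameter intervals into a function on the ambient space.  The
  parameter of a point is its distance from the starting point of its edge.  At a vertex the value
  depends on the choice of an edge, but only interior points matter.
\<close>
definition glue :: "('i \<Rightarrow> real \<Rightarrow> real) \<Rightarrow> real ^ 'd \<Rightarrow> real" where
  "glue f x = (let \<alpha> = (SOME \<alpha>. \<alpha> \<in> idx N \<and> x \<in> edge N \<alpha>) in f \<alpha> (dist (src N \<alpha>) x))"

lemma on_edge_glue: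
  assumes \<alpha>: "\<alpha> \<in> idx N" and s: "s \<in> {0<..<edge_length N \<alpha>}"
  shows "on_edge N (glue f) \<alpha> s = f \<alpha> s"
proof -
  let ?x = "edge_param N \<alpha> s"
  have "(SOME \<beta>. \<beta> \<in> idx N \<and> ?x \<in> edge N \<beta>) = \<alpha>"
  proof (rule some_equality)
    show "\<alpha> \<in> idx N \<and> ?x \<in> edge N \<alpha>" using edge_param_in_edge[OF \<alpha> s] \<alpha> by simp
    fix \<beta> assume "\<beta> \<in> idx N \<and> ?x \<in> edge N \<beta>"
    then show "\<beta> = \<alpha>" using edge_inter(1)[of \<alpha> \<beta> ?x] edge_param_in_edge[OF \<alpha> s] edge_param_not_vertex[OF \<alpha> s] \<alpha> by blast
  qed
  then show ?thesis using s by (simp add: on_edge_def glue_def Let_def dist_edge_param[OF \<alpha>])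
qed

text \<open>
  Evaluates the definite description in \<open>edge_trace\<close>: every competing continuous representative
  coincides with \<open>F\<close> in the interior of the edge and so has the same limits at the ends.
\<close>
lemma edge_trace_continuous:
  assumes \<alpha>: "\<alpha> \<in> idx N" and F: "continuous_on {0..edge_length N \<alpha>} F"
    and ae: "AE s in leb_edge N \<alpha>. on_edge N u \<alpha> s = F s"
  shows "edge_trace N u \<alpha> (src N \<alpha>) = F 0" "edge_trace N u \<alpha> (tgt N \<alpha>) = F (edge_length N \<alpha>)"
proof -
  let ?L = "edge_length N \<alpha>"
  have L: "0 < ?L" by (rule edge_length_pos[OF \<alpha>])
  have cF: "continuous_on {0<..<?L} F" using F by (rule continuous_on_subset) auto
  have lim: "(F \<longlongrightarrow> F 0) (at_right 0)" "(F \<longlongrightarrow> F ?L) (at_left ?L)"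
    using F L by (auto dest: continuous_on_Icc_at_rightD continuous_on_Icc_at_leftD)
  have ae': "AE s in leb_edge N \<alpha>. F s = on_edge N u \<alpha> s" using ae by auto
  have eq: "w s = F s" if "continuous_on {0<..<?L} w" "AE s in leb_edge N \<alpha>. w s = on_edge N u \<alpha> s"
    "s \<in> {0<..<?L}" for w s
  proof (rule AE_eq_continuous_imp_eq[OF that(1) cF _ that(3)])
    show "AE s in leb_edge N \<alpha>. w s = F s" using that(2) ae by eventually_elim simp
  qed
  have r: "\<forall>\<^sub>F s in at_right 0. s \<in> {0<..<?L}" using L by (auto simp: eventually_at_right intro!: exI[of _ ?L])
  have l: "\<forall>\<^sub>F s in at_left ?L. s \<in> {0<..<?L}" using L by (auto simp: eventually_at_left intro!: exI[of _ 0])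
  show "edge_trace N u \<alpha> (src N \<alpha>) = F 0"
    unfolding edge_trace_def
  proof (rule the_equality)
    fix c assume "\<exists>w. continuous_on {0<..<?L} w \<and> (AE s in leb_edge N \<alpha>. w s = on_edge N u \<alpha> s) \<and>
      (w \<longlongrightarrow> c) (if src N \<alpha> = src N \<alpha> then at_right 0 else at_left ?L)"
    then obtain w where w: "continuous_on {0<..<?L} w" "AE s in leb_edge N \<alpha>. w s = on_edge N u \<alpha> s"
      "(w \<longlongrightarrow> c) (at_right 0)" by auto
    have "\<forall>\<^sub>F s in at_right 0. w s = F s" using r by eventually_elim (rule eq[OF w(1,2)])
    from Lim_transform_eventually[OF w(3) this] show "c = F 0"
      using tendsto_unique[OF _ _ lim(1)] by simp
  qed (use cF ae' lim in auto)
  show "edge_trace N u \<alpha> (tgt N \<alpha>) = F ?L"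
    unfolding edge_trace_def
  proof (rule the_equality)
    fix c assume "\<exists>w. continuous_on {0<..<?L} w \<and> (AE s in leb_edge N \<alpha>. w s = on_edge N u \<alpha> s) \<and>
      (w \<longlongrightarrow> c) (if tgt N \<alpha> = src N \<alpha> then at_right 0 else at_left ?L)"
    then obtain w where w: "continuous_on {0<..<?L} w" "AE s in leb_edge N \<alpha>. w s = on_edge N u \<alpha> s"
      "(w \<longlongrightarrow> c) (at_left ?L)" using src_neq_tgt[OF \<alpha>] by auto
    have "\<forall>\<^sub>F s in at_left ?L. w s = F s" using l by eventually_elim (rule eq[OF w(1,2)])
    from Lim_transform_eventually[OF w(3) this] show "c = F ?L"
      using tendsto_unique[OF _ _ lim(2)] by simp
  qed (use cF ae' lim src_neq_tgt[OF \<alpha>] in auto)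
qed

lemma W12_edge_primitive:
  assumes u: "u \<in> W12 N" and \<alpha>: "\<alpha> \<in> idx N"
  shows "net_deriv N u \<alpha> \<in> L2_interval (edge_length N \<alpha>)"
    "AE s in leb_edge N \<alpha>. on_edge N u \<alpha> s = edge_trace N u \<alpha> (src N \<alpha>) + integral {0..s} (net_deriv N u \<alpha>)"
    "edge_trace N u \<alpha> (tgt N \<alpha>) =
      edge_trace N u \<alpha> (src N \<alpha>) + integral {0..edge_length N \<alpha>} (net_deriv N u \<alpha>)"
proof -
  have W: "on_edge N u \<alpha> \<in> W12_interval (edge_length N \<alpha>)" using u \<alpha> by (simp add: W12_def)
  show L2: "net_deriv N u \<alpha> \<in> L2_interval (edge_length N \<alpha>)"
    unfolding net_deriv_def by (rule weak_deriv_L2[OF W])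
  obtain C where C: "AE s in leb_edge N \<alpha>. on_edge N u \<alpha> s = C + integral {0..s} (net_deriv N u \<alpha>)"
    using W12_interval_primitive[OF edge_length_pos[OF \<alpha>] W] unfolding net_deriv_def by blast
  note tr = edge_trace_continuous[OF \<alpha> continuous_on_primitive[OF L2_imp_integrable[OF L2]] C]
  then have "C = edge_trace N u \<alpha> (src N \<alpha>)" by simp
  then show "AE s in leb_edge N \<alpha>. on_edge N u \<alpha> s = edge_trace N u \<alpha> (src N \<alpha>) + integral {0..s} (net_deriv N u \<alpha>)"
    "edge_trace N u \<alpha> (tgt N \<alpha>) =
      edge_trace N u \<alpha> (src N \<alpha>) + integral {0..edge_length N \<alpha>} (net_deriv N u \<alpha>)"
    using C tr by auto
qed

text \<open>
  The converse of \<open>W12_edge_primitive\<close>, by which all test functions and the solution itself are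
  constructed.
\<close>
lemma glue_primitive:
  assumes g: "\<forall>\<alpha>\<in>idx N. g \<alpha> \<in> L2_interval (edge_length N \<alpha>)"
    and f: "\<forall>\<alpha>\<in>idx N. \<forall>s\<in>{0..edge_length N \<alpha>}. f \<alpha> s = C \<alpha> + integral {0..s} (g \<alpha>)"
  shows "glue f \<in> W12 N"
    and "\<And>\<alpha>. \<alpha> \<in> idx N \<Longrightarrow> AE s in leb_edge N \<alpha>. net_deriv N (glue f) \<alpha> s = g \<alpha> s"
    and "\<And>\<alpha>. \<alpha> \<in> idx N \<Longrightarrow> edge_trace N (glue f) \<alpha> (src N \<alpha>) = f \<alpha> 0"
    and "\<And>\<alpha>. \<alpha> \<in> idx N \<Longrightarrow> edge_trace N (glue f) \<alpha> (tgt N \<alpha>) = f \<alpha> (edge_length N \<alpha>)"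
proof -
  have on: "on_edge N (glue f) \<alpha> s = C \<alpha> + integral {0..s} (g \<alpha>)"
    if "\<alpha> \<in> idx N" "s \<in> {0<..<edge_length N \<alpha>}" for \<alpha> s
    using on_edge_glue[OF that] f that by simp
  show "glue f \<in> W12 N"
    unfolding W12_def using has_weak_deriv_primitive(2)[OF g[rule_format] on] by blast
  fix \<alpha> assume \<alpha>: "\<alpha> \<in> idx N"
  show "AE s in leb_edge N \<alpha>. net_deriv N (glue f) \<alpha> s = g \<alpha> s"
    unfolding net_deriv_def by (rule weak_deriv_primitive[OF g[rule_format, OF \<alpha>] on[OF \<alpha>]])
  have "AE s in leb_edge N \<alpha>. on_edge N (glue f) \<alpha> s = C \<alpha> + integral {0..s} (g \<alpha>)"
    by (rule AE_I2) (simp add: on[OF \<alpha>])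
  note tr = edge_trace_continuous[OF \<alpha> continuous_on_primitive[OF L2_imp_integrable[OF g[rule_format, OF \<alpha>]]] this]
  show "edge_trace N (glue f) \<alpha> (src N \<alpha>) = f \<alpha> 0"
    "edge_trace N (glue f) \<alpha> (tgt N \<alpha>) = f \<alpha> (edge_length N \<alpha>)"
    using tr f[rule_format, OF \<alpha>] edge_length_pos[OF \<alpha>] by auto
qed

text \<open>
  Extends the vertex values \<open>T\<^sub>v[u]\<close> to boundary vertices, with factor 1, so that inner and
  boundary vertices can be treated alike.
\<close>
definition has_vertex_values :: 
  "(real ^ 'd \<Rightarrow> 'i \<Rightarrow> real) \<Rightarrow> (real ^ 'd \<Rightarrow> real) \<Rightarrow> (real ^ 'd \<Rightarrow> real) \<Rightarrow> bool" where
  "has_vertex_values \<gamma> u T \<longleftrightarrow> (\<forall>v\<in>verts N. \<forall>\<alpha>\<in>edges_at N v.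
     edge_trace N u \<alpha> v = (if v \<in> boundary_verts N then 1 else \<gamma> v \<alpha>) * T v)"

text \<open>
  At a boundary vertex there is a single edge, whose trace serves as the vertex value.
\<close>
lemma V12_jump_vertex_values:
  assumes u: "u \<in> V12_jump N \<gamma>" and \<gamma>: "\<And>v \<alpha>. v \<in> inner_verts N \<Longrightarrow> \<alpha> \<in> edges_at N v \<Longrightarrow> \<gamma> v \<alpha> \<noteq> 0"
  obtains T where "has_vertex_values \<gamma> u T"
proof -
  define e where "e v = (SOME \<alpha>. \<alpha> \<in> edges_at N v)" for v
  have e: "e v \<in> edges_at N v" if "v \<in> verts N" for v
    unfolding e_def using edges_at_nonempty[OF that] by (simp add: some_in_eq)
  define T where "T v = edge_trace N u (e v) v / (if v \<in> boundary_verts N then 1 else \<gamma> v (e v))" for v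
  have "edge_trace N u \<alpha> v = (if v \<in> boundary_verts N then 1 else \<gamma> v \<alpha>) * T v"
    if v: "v \<in> verts N" and \<alpha>: "\<alpha> \<in> edges_at N v" for v \<alpha>
  proof (cases "v \<in> boundary_verts N")
    case True
    then show ?thesis using edge_at_boundary_unique[OF True \<alpha> e[OF v]] by (simp add: T_def)
  next
    case False
    then have inner: "v \<in> inner_verts N" using v by simp
    have "\<forall>v\<in>inner_verts N. \<forall>\<alpha>\<in>edges_at N v. \<forall>\<beta>\<in>edges_at N v.
        edge_trace N u \<alpha> v / \<gamma> v \<alpha> = edge_trace N u \<beta> v / \<gamma> v \<beta>"
      by (rule conjunct2[OF u[unfolded V12_jump_def, THEN CollectD]])
    from this[THEN bspec, OF inner, THEN bspec, OF \<alpha>, THEN bspec, OF e[OF v]]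
    have "edge_trace N u \<alpha> v / \<gamma> v \<alpha> = T v" using False by (simp add: T_def)
    then show ?thesis using False \<gamma>[OF inner \<alpha>] by (simp add: field_simps)
  qed
  then show thesis by (intro that[of T]) (simp add: has_vertex_values_def)
qed

lemma vertex_values_V12_jump:
  assumes u: "u \<in> W12 N" "has_vertex_values \<gamma> u T"
    and \<gamma>: "\<And>v \<alpha>. v \<in> inner_verts N \<Longrightarrow> \<alpha> \<in> edges_at N v \<Longrightarrow> \<gamma> v \<alpha> \<noteq> 0"
  shows "u \<in> V12_jump N \<gamma>"
proof -
  have "edge_trace N u \<alpha> v / \<gamma> v \<alpha> = T v" if "v \<in> inner_verts N" "\<alpha> \<in> edges_at N v" for v \<alpha>
    using u(2) \<gamma>[OF that] that by (simp add: has_vertex_values_def)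
  then show ?thesis using u(1) unfolding V12_jump_def by simp
qed

lemma vertex_value_eq:
  assumes u: "has_vertex_values \<gamma> u T" and v: "v \<in> inner_verts N"
    and \<gamma>: "\<And>v \<alpha>. v \<in> inner_verts N \<Longrightarrow> \<alpha> \<in> edges_at N v \<Longrightarrow> \<gamma> v \<alpha> \<noteq> 0"
  shows "vertex_value N \<gamma> u v = T v"
proof -
  have eq: "edge_trace N u \<alpha> v / \<gamma> v \<alpha> = T v" if "\<alpha> \<in> edges_at N v" for \<alpha>
    using u v \<gamma>[OF v that] that by (auto simp: has_vertex_values_def)
  obtain \<alpha> where "\<alpha> \<in> edges_at N v" using edges_at_nonempty v by blast
  then show ?thesis unfolding vertex_value_def using eq by (intro the_equality) auto
qed

lemma has_vertex_values_iff:
  "has_vertex_values \<gamma> u T \<longleftrightarrow> (\<forall>\<alpha>\<in>idx N.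
     edge_trace N u \<alpha> (src N \<alpha>) = (if src N \<alpha> \<in> boundary_verts N then 1 else \<gamma> (src N \<alpha>) \<alpha>) * T (src N \<alpha>) \<and>
     edge_trace N u \<alpha> (tgt N \<alpha>) = (if tgt N \<alpha> \<in> boundary_verts N then 1 else \<gamma> (tgt N \<alpha>) \<alpha>) * T (tgt N \<alpha>))"
  (is "?l = ?r")
proof
  assume ?l
  show ?r
  proof
    fix \<alpha> assume \<alpha>: "\<alpha> \<in> idx N"
    have "\<alpha> \<in> edges_at N (src N \<alpha>)" "\<alpha> \<in> edges_at N (tgt N \<alpha>)"
      using \<alpha> ends_in_edge by (auto simp: edges_at_def)
    then show "edge_trace N u \<alpha> (src N \<alpha>) = (if src N \<alpha> \<in> boundary_verts N then 1 else \<gamma> (src N \<alpha>) \<alpha>) * T (src N \<alpha>) \<and>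
     edge_trace N u \<alpha> (tgt N \<alpha>) = (if tgt N \<alpha> \<in> boundary_verts N then 1 else \<gamma> (tgt N \<alpha>) \<alpha>) * T (tgt N \<alpha>)"
      using \<open>?l\<close> src_in[OF \<alpha>] tgt_in[OF \<alpha>] unfolding has_vertex_values_def by blast
  qed
next
  assume ?r
  show ?l unfolding has_vertex_values_def
  proof (intro ballI)
    fix v \<alpha> assume "v \<in> verts N" "\<alpha> \<in> edges_at N v"
    then have "\<alpha> \<in> idx N" "v = src N \<alpha> \<or> v = tgt N \<alpha>" using edges_at_eq by auto
    then show "edge_trace N u \<alpha> v = (if v \<in> boundary_verts N then 1 else \<gamma> v \<alpha>) * T v"
      using \<open>?r\<close> by metis
  qed
qed

end

section \<open>The Fokker--Planck problem\<close>
locale fokker_planck = valid_network N for N :: "('d::finite, 'i) network" +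
  fixes \<mu> :: "'i \<Rightarrow> real" and \<eta> :: "real ^ 'd \<Rightarrow> real"
    and \<gamma> :: "real ^ 'd \<Rightarrow> 'i \<Rightarrow> real" and b :: "real ^ 'd \<Rightarrow> real"
  assumes parameters: "fp_parameters N \<mu> \<eta> \<gamma>" and drift_PC: "b \<in> PC N"
begin

lemma \<mu>_pos: "\<alpha> \<in> idx N \<Longrightarrow> 0 < \<mu> \<alpha>"
  using parameters by (simp add: fp_parameters_def)

lemma \<eta>_nonneg: "v \<in> inner_verts N \<Longrightarrow> 0 \<le> \<eta> v"
  using parameters unfolding fp_parameters_def by blast

lemma \<gamma>_pos: "v \<in> inner_verts N \<Longrightarrow> \<alpha> \<in> edges_at N v \<Longrightarrow> 0 < \<gamma> v \<alpha>"
  using parameters unfolding fp_parameters_def by blast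

lemma \<gamma>_nonzero: "v \<in> inner_verts N \<Longrightarrow> \<alpha> \<in> edges_at N v \<Longrightarrow> \<gamma> v \<alpha> \<noteq> 0"
  using \<gamma>_pos by fastforce

definition vertex_weight :: "real ^ 'd \<Rightarrow> 'i \<Rightarrow> real" where
  "vertex_weight v \<alpha> = (if v \<in> boundary_verts N then 1 else \<gamma> v \<alpha>)"

lemma vertex_weight_pos: assumes "\<alpha> \<in> idx N" shows "0 < vertex_weight (src N \<alpha>) \<alpha>" "0 < vertex_weight (tgt N \<alpha>) \<alpha>"
proof -
  have "\<alpha> \<in> edges_at N (src N \<alpha>)" "\<alpha> \<in> edges_at N (tgt N \<alpha>)"
    using assms ends_in_edge by (auto simp: edges_at_def)
  then show "0 < vertex_weight (src N \<alpha>) \<alpha>" "0 < vertex_weight (tgt N \<alpha>) \<alpha>"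
    using \<gamma>_pos src_in[OF assms] tgt_in[OF assms] by (auto simp: vertex_weight_def)
qed

text \<open>
  The drift relative to the diffusion coefficient, extended continuously to the closed parameter
  interval.
\<close>
definition drift :: "'i \<Rightarrow> real \<Rightarrow> real" where
  "drift \<alpha> = (SOME \<beta>. continuous_on {0..edge_length N \<alpha>} \<beta> \<and>
     (\<forall>s\<in>{0<..<edge_length N \<alpha>}. \<beta> s = on_edge N b \<alpha> s / \<mu> \<alpha>))"

lemma drift:
  assumes \<alpha>: "\<alpha> \<in> idx N"
  shows continuous_drift: "continuous_on {0..edge_length N \<alpha>} (drift \<alpha>)"
    and on_edge_drift: "s \<in> {0<..<edge_length N \<alpha>} \<Longrightarrow> on_edge N b \<alpha> s = \<mu> \<alpha> * drift \<alpha> s"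
proof -
  let ?L = "edge_length N \<alpha>"
  obtain l r where lr: "continuous_on {0<..<?L} (on_edge N b \<alpha>)"
    "(on_edge N b \<alpha> \<longlongrightarrow> l) (at_right 0)" "(on_edge N b \<alpha> \<longlongrightarrow> r) (at_left ?L)"
    using drift_PC \<alpha> by (auto simp: PC_def)
  obtain h where h: "continuous_on {0..?L} h" "\<And>s. s \<in> {0<..<?L} \<Longrightarrow> h s = on_edge N b \<alpha> s"
    using continuous_extension_closed_interval[OF edge_length_pos[OF \<alpha>] lr] by blast
  have "\<exists>\<beta>. continuous_on {0..?L} \<beta> \<and> (\<forall>s\<in>{0<..<?L}. \<beta> s = on_edge N b \<alpha> s / \<mu> \<alpha>)"
    using h \<mu>_pos[OF \<alpha>] by (intro exI[of _ "\<lambda>s. h s / \<mu> \<alpha>"]) (auto intro!: continuous_intros)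
  then have d: "continuous_on {0..?L} (drift \<alpha>) \<and> (\<forall>s\<in>{0<..<?L}. drift \<alpha> s = on_edge N b \<alpha> s / \<mu> \<alpha>)"
    unfolding drift_def by (rule someI_ex)
  then show "continuous_on {0..?L} (drift \<alpha>)" by blast
  show "s \<in> {0<..<?L} \<Longrightarrow> on_edge N b \<alpha> s = \<mu> \<alpha> * drift \<alpha> s"
    using d \<mu>_pos[OF \<alpha>] by simp
qed

text \<open>
  The factor in Ohm's law for an edge: by \<open>flux_eq\<close>, the flux is the difference of the end values,
  the one at the target weighted by the exponential of the potential there, divided by the
  resistance.
\<close>
definition resistance :: "'i \<Rightarrow> real" where
  "resistance \<alpha> = scale_fun (drift \<alpha>) (edge_length N \<alpha>) / \<mu> \<alpha>"

lemma resistance_pos: "\<alpha> \<in> idx N \<Longrightarrow> 0 < resistance \<alpha>"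
  unfolding resistance_def
  using scale_fun_pos[OF edge_length_pos continuous_drift] \<mu>_pos by simp

definition backward_rate :: "'i \<Rightarrow> real" where
  "backward_rate \<alpha> = exp (potential (drift \<alpha>) (edge_length N \<alpha>)) * vertex_weight (tgt N \<alpha>) \<alpha> / resistance \<alpha>"

definition forward_rate :: "'i \<Rightarrow> real" where
  "forward_rate \<alpha> = vertex_weight (src N \<alpha>) \<alpha> / resistance \<alpha>"

sublocale exchange_network "verts N" "idx N" "src N" "tgt N" backward_rate forward_rate
  by unfold_locales
    (use finite_verts verts_nonempty finite_idx src_in tgt_in closed_under_edges_imp_all vertex_weight_pos resistance_pos
      in \<open>auto simp: backward_rate_def forward_rate_def\<close>)

text \<open>The solution of the equation on the edge \<open>\<alpha>\<close> with the end values prescribed by \<open>T\<close>.\<close>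
definition edge_sol :: "(real ^ 'd \<Rightarrow> real) \<Rightarrow> 'i \<Rightarrow> real \<Rightarrow> real" where
  "edge_sol T \<alpha> = profile (drift \<alpha>) (vertex_weight (src N \<alpha>) \<alpha> * T (src N \<alpha>)) (flux T \<alpha> / \<mu> \<alpha>)"

lemma flux_eq:
  assumes \<alpha>: "\<alpha> \<in> idx N"
  shows "flux T \<alpha> / \<mu> \<alpha> = (exp (potential (drift \<alpha>) (edge_length N \<alpha>)) * (vertex_weight (tgt N \<alpha>) \<alpha> * T (tgt N \<alpha>))
      - vertex_weight (src N \<alpha>) \<alpha> * T (src N \<alpha>)) / scale_fun (drift \<alpha>) (edge_length N \<alpha>)"
  using \<mu>_pos[OF \<alpha>] by (simp add: flux_def backward_rate_def forward_rate_def resistance_def diff_divide_distrib)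

lemma edge_sol_ends:
  assumes \<alpha>: "\<alpha> \<in> idx N"
  shows "edge_sol T \<alpha> 0 = vertex_weight (src N \<alpha>) \<alpha> * T (src N \<alpha>)"
    and "edge_sol T \<alpha> (edge_length N \<alpha>) = vertex_weight (tgt N \<alpha>) \<alpha> * T (tgt N \<alpha>)"
  unfolding edge_sol_def
  using profile_end[OF edge_length_pos[OF \<alpha>] continuous_drift[OF \<alpha>] flux_eq[OF \<alpha>]] by auto

lemma continuous_sol: "\<alpha> \<in> idx N \<Longrightarrow> continuous_on {0..edge_length N \<alpha>} (edge_sol T \<alpha>)"
  unfolding edge_sol_def by (rule continuous_profile[OF edge_length_pos continuous_drift])

lemma edge_sol_pos:
  assumes \<alpha>: "\<alpha> \<in> idx N" and T: "\<And>v. v \<in> verts N \<Longrightarrow> 0 < T v" and s: "s \<in> {0..edge_length N \<alpha>}"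
  shows "0 < edge_sol T \<alpha> s"
  using profile_pos[OF edge_length_pos[OF \<alpha>] continuous_drift[OF \<alpha>] _ _ s]
    edge_sol_ends(2)[OF \<alpha>, of T] vertex_weight_pos[OF \<alpha>] T src_in[OF \<alpha>] tgt_in[OF \<alpha>]
  unfolding edge_sol_def by (metis mult_pos_pos)

lemma edge_sol_scale:
  assumes \<alpha>: "\<alpha> \<in> idx N" and T: "\<And>v. v \<in> verts N \<Longrightarrow> T' v = k * T v"
  shows "edge_sol T' \<alpha> s = k * edge_sol T \<alpha> s"
proof -
  have T': "T' (src N \<alpha>) = k * T (src N \<alpha>)" "T' (tgt N \<alpha>) = k * T (tgt N \<alpha>)"
    using T src_in[OF \<alpha>] tgt_in[OF \<alpha>] by auto
  have "flux T' \<alpha> = k * flux T \<alpha>" using T' by (simp add: flux_def algebra_simps)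
  then show ?thesis unfolding edge_sol_def profile_scale[symmetric] by (simp add: T' mult.left_commute)
qed

lemma
  shows glue_sol_W12: "glue (edge_sol T) \<in> W12 N"
    and glue_sol_vertex_values: "has_vertex_values \<gamma> (glue (edge_sol T)) T"
    and glue_sol_flux: "\<And>\<alpha>. \<alpha> \<in> idx N \<Longrightarrow> AE s in leb_edge N \<alpha>.
      \<mu> \<alpha> * net_deriv N (glue (edge_sol T)) \<alpha> s + on_edge N b \<alpha> s * on_edge N (glue (edge_sol T)) \<alpha> s = flux T \<alpha>"
proof -
  define g where "g = (\<lambda>\<alpha> s. flux T \<alpha> / \<mu> \<alpha> - drift \<alpha> s * edge_sol T \<alpha> s)"
  have L2: "\<forall>\<alpha>\<in>idx N. g \<alpha> \<in> L2_interval (edge_length N \<alpha>)"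
    unfolding g_def
    by (intro ballI continuous_imp_L2 continuous_intros continuous_sol continuous_drift)
  have eq: "\<forall>\<alpha>\<in>idx N. \<forall>s\<in>{0..edge_length N \<alpha>}.
      edge_sol T \<alpha> s = vertex_weight (src N \<alpha>) \<alpha> * T (src N \<alpha>) + integral {0..s} (g \<alpha>)"
    unfolding g_def edge_sol_def
    by (intro ballI profile_eq_integral[OF edge_length_pos continuous_drift])
  note gp = glue_primitive[OF L2 eq]
  show "glue (edge_sol T) \<in> W12 N" by (rule gp(1))
  show "has_vertex_values \<gamma> (glue (edge_sol T)) T"
    unfolding has_vertex_values_iff using gp(3,4) edge_sol_ends by (simp add: vertex_weight_def)
  fix \<alpha> assume \<alpha>: "\<alpha> \<in> idx N"
  show "AE s in leb_edge N \<alpha>.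
      \<mu> \<alpha> * net_deriv N (glue (edge_sol T)) \<alpha> s + on_edge N b \<alpha> s * on_edge N (glue (edge_sol T)) \<alpha> s = flux T \<alpha>"
    by (rule lebesgue_on_mono[OF gp(2)[OF \<alpha>]])
      (use \<mu>_pos[OF \<alpha>] in \<open>simp add: on_edge_glue[OF \<alpha>] on_edge_drift[OF \<alpha>] g_def field_simps\<close>)
qed

lemma integrable_flux_density:
  assumes m: "m \<in> W12 N" and \<alpha>: "\<alpha> \<in> idx N"
  shows "integrable (leb_edge N \<alpha>) (\<lambda>s. \<mu> \<alpha> * net_deriv N m \<alpha> s + on_edge N b \<alpha> s * on_edge N m \<alpha> s)"
proof -
  let ?M = "leb_edge N \<alpha>"
  have im: "integrable ?M (on_edge N m \<alpha>)"
    using m \<alpha> by (auto simp: W12_def W12_interval_def intro: L2_imp_integrable)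
  have "integrable ?M (\<lambda>s. \<mu> \<alpha> * (on_edge N m \<alpha> s * drift \<alpha> s))"
    using integrable_mult_continuous[OF im continuous_drift[OF \<alpha>]] by simp
  then have "integrable ?M (\<lambda>s. on_edge N b \<alpha> s * on_edge N m \<alpha> s)"
    by (rule Bochner_Integration.integrable_cong[THEN iffD1, OF refl, rotated])
      (simp add: on_edge_drift[OF \<alpha>] mult_ac)
  then show ?thesis
    using L2_imp_integrable[OF W12_edge_primitive(1)[OF m \<alpha>]] by simp
qed

text \<open>
  For constant flux on every edge, the weak form reduces to the increments of the test function
  along the edges.
\<close>
lemma weak_form_eq_sum:
  assumes m: "m \<in> W12 N" and v: "v \<in> W12 N" and \<psi>: "has_vertex_values (\<lambda>_ _. 1) v \<psi>"
    and c: "\<And>\<alpha>. \<alpha> \<in> idx N \<Longrightarrow> AE s in leb_edge N \<alpha>.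
      \<mu> \<alpha> * net_deriv N m \<alpha> s + on_edge N b \<alpha> s * on_edge N m \<alpha> s = c \<alpha>"
  shows "net_integral N (\<lambda>\<alpha> s. \<mu> \<alpha> * net_deriv N m \<alpha> s * net_deriv N v \<alpha> s
      + on_edge N b \<alpha> s * on_edge N m \<alpha> s * net_deriv N v \<alpha> s)
    = (\<Sum>\<alpha>\<in>idx N. c \<alpha> * (\<psi> (tgt N \<alpha>) - \<psi> (src N \<alpha>)))"
  unfolding net_integral_def
proof (rule sum.cong[OF refl])
  fix \<alpha> assume \<alpha>: "\<alpha> \<in> idx N"
  let ?M = "leb_edge N \<alpha>" and ?h = "\<lambda>s. \<mu> \<alpha> * net_deriv N m \<alpha> s + on_edge N b \<alpha> s * on_edge N m \<alpha> s"
  have iv: "integrable ?M (net_deriv N v \<alpha>)"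
    by (rule L2_imp_integrable[OF W12_edge_primitive(1)[OF v \<alpha>]])
  have tr: "edge_trace N v \<alpha> (src N \<alpha>) = \<psi> (src N \<alpha>)" "edge_trace N v \<alpha> (tgt N \<alpha>) = \<psi> (tgt N \<alpha>)"
    using \<psi> \<alpha> unfolding has_vertex_values_iff by auto
  have "(\<integral>s. \<mu> \<alpha> * net_deriv N m \<alpha> s * net_deriv N v \<alpha> s
      + on_edge N b \<alpha> s * on_edge N m \<alpha> s * net_deriv N v \<alpha> s \<partial>?M) = (\<integral>s. ?h s * net_deriv N v \<alpha> s \<partial>?M)"
    by (simp add: distrib_right)
  also have "\<dots> = (\<integral>s. c \<alpha> * net_deriv N v \<alpha> s \<partial>?M)"
  proof (rule integral_cong_AE)
    show "(\<lambda>s. ?h s * net_deriv N v \<alpha> s) \<in> borel_measurable ?M"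
      by (intro borel_measurable_times borel_measurable_integrable iv integrable_flux_density m \<alpha>)
    show "(\<lambda>s. c \<alpha> * net_deriv N v \<alpha> s) \<in> borel_measurable ?M" using iv by simp
    show "AE s in ?M. ?h s * net_deriv N v \<alpha> s = c \<alpha> * net_deriv N v \<alpha> s"
      using c[OF \<alpha>] by eventually_elim simp
  qed
  also have "\<dots> = c \<alpha> * integral {0..edge_length N \<alpha>} (net_deriv N v \<alpha>)"
    using integral_ivl_eq[OF iv] by simp
  also have "\<dots> = c \<alpha> * (\<psi> (tgt N \<alpha>) - \<psi> (src N \<alpha>))"
    using W12_edge_primitive(3)[OF v \<alpha>] tr by simp
  finally show "(\<integral>s. \<mu> \<alpha> * net_deriv N m \<alpha> s * net_deriv N v \<alpha> s
      + on_edge N b \<alpha> s * on_edge N m \<alpha> s * net_deriv N v \<alpha> s \<partial>?M) = c \<alpha> * (\<psi> (tgt N \<alpha>) - \<psi> (src N \<alpha>))" .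
qed

definition weak_equation :: "(real ^ 'd \<Rightarrow> real) \<Rightarrow> bool" where
  "weak_equation m \<longleftrightarrow> (\<forall>v\<in>V12 N. net_integral N (\<lambda>\<alpha> s. \<mu> \<alpha> * net_deriv N m \<alpha> s * net_deriv N v \<alpha> s
      + on_edge N b \<alpha> s * on_edge N m \<alpha> s * net_deriv N v \<alpha> s) = 0)"

lemma V12I: "v \<in> W12 N \<Longrightarrow> has_vertex_values (\<lambda>_ _. 1) v \<psi> \<Longrightarrow> v \<in> V12 N"
  unfolding V12_def by (rule vertex_values_V12_jump) auto

lemma V12E:
  assumes "v \<in> V12 N"
  obtains \<psi> where "v \<in> W12 N" "has_vertex_values (\<lambda>_ _. 1) v \<psi>"
proof -
  have "v \<in> W12 N" using assms by (simp add: V12_def V12_jump_def)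
  moreover obtain \<psi> where "has_vertex_values (\<lambda>_ _. 1) v \<psi>"
    using assms V12_jump_vertex_values[of v "\<lambda>_ _. 1"] unfolding V12_def by auto
  ultimately show thesis by (rule that)
qed

text \<open>
  A test function on one edge, extended by zero, vanishes at all vertices and so belongs to
  \<open>V12 N\<close>.
\<close>
lemma constant_flux_if_weak_equation:
  assumes m: "m \<in> W12 N" and weak: "weak_equation m" and \<alpha>: "\<alpha> \<in> idx N"
  obtains c where "AE s in leb_edge N \<alpha>.
      \<mu> \<alpha> * net_deriv N m \<alpha> s + on_edge N b \<alpha> s * on_edge N m \<alpha> s = c"
proof (rule du_Bois_Reymond[OF edge_length_pos[OF \<alpha>] integrable_flux_density[OF m \<alpha>]])
  fix \<phi> assume \<phi>: "test_fun (edge_length N \<alpha>) \<phi>"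
  define f where "f = (\<lambda>\<beta> s. if \<beta> = \<alpha> then \<phi> s else 0)"
  define g where "g = (\<lambda>\<beta> s. if \<beta> = \<alpha> then deriv \<phi> s else 0)"
  have L2: "g \<beta> \<in> L2_interval (edge_length N \<beta>)" for \<beta>
    unfolding g_def using test_fun_deriv(2)[OF \<phi>] by (cases "\<beta> = \<alpha>") (auto intro: continuous_imp_L2)
  have \<phi>0: "\<phi> 0 = 0" "\<phi> (edge_length N \<alpha>) = 0"
    using test_fun_zero_left[OF \<phi>] test_fun_zero_right[OF \<phi>] by auto
  have eq: "\<forall>\<beta>\<in>idx N. \<forall>s\<in>{0..edge_length N \<beta>}. f \<beta> s = 0 + integral {0..s} (g \<beta>)"
  proof (intro ballI)
    fix \<beta> s assume s: "s \<in> {0..edge_length N \<beta>}"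
    have "(deriv \<phi> has_integral (\<phi> s - \<phi> 0)) {0..s}"
      using s test_fun_deriv(1)[OF \<phi>] by (intro fundamental_theorem_of_calculus)
        (auto simp: has_real_derivative_iff_has_vector_derivative intro: has_vector_derivative_at_within)
    then show "f \<beta> s = 0 + integral {0..s} (g \<beta>)" using \<phi>0 by (simp add: f_def g_def integral_unique)
  qed
  let ?v = "glue f"
  note gp = glue_primitive[of g f "\<lambda>_. 0", OF ballI[OF L2] eq]
  have "has_vertex_values (\<lambda>_ _. 1) ?v (\<lambda>_. 0)"
    unfolding has_vertex_values_iff using gp(3,4) \<phi>0 by (auto simp: f_def)
  then have v: "?v \<in> V12 N" using V12I gp(1) by blast
  let ?h = "\<lambda>\<beta> s. \<mu> \<beta> * net_deriv N m \<beta> s + on_edge N b \<beta> s * on_edge N m \<beta> s"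
  have "(\<integral>s. \<mu> \<beta> * net_deriv N m \<beta> s * net_deriv N ?v \<beta> s
      + on_edge N b \<beta> s * on_edge N m \<beta> s * net_deriv N ?v \<beta> s \<partial>leb_edge N \<beta>) 
    = (if \<beta> = \<alpha> then (\<integral>s. ?h \<alpha> s * deriv \<phi> s \<partial>leb_edge N \<alpha>) else 0)" if \<beta>: "\<beta> \<in> idx N" for \<beta>
  proof -
    have "(\<integral>s. \<mu> \<beta> * net_deriv N m \<beta> s * net_deriv N ?v \<beta> s
        + on_edge N b \<beta> s * on_edge N m \<beta> s * net_deriv N ?v \<beta> s \<partial>leb_edge N \<beta>)
      = (\<integral>s. ?h \<beta> s * net_deriv N ?v \<beta> s \<partial>leb_edge N \<beta>)"
      by (simp add: distrib_right)
    also have "\<dots> = (\<integral>s. ?h \<beta> s * g \<beta> s \<partial>leb_edge N \<beta>)"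
    proof (rule integral_cong_AE)
      show "(\<lambda>s. ?h \<beta> s * net_deriv N ?v \<beta> s) \<in> borel_measurable (leb_edge N \<beta>)"
        by (intro borel_measurable_times borel_measurable_integrable L2_imp_integrable W12_edge_primitive(1)
            gp(1) integrable_flux_density m \<beta>)
      show "(\<lambda>s. ?h \<beta> s * g \<beta> s) \<in> borel_measurable (leb_edge N \<beta>)"
        by (intro borel_measurable_times borel_measurable_integrable L2_imp_integrable L2
            integrable_flux_density m \<beta>)
      show "AE s in leb_edge N \<beta>. ?h \<beta> s * net_deriv N ?v \<beta> s = ?h \<beta> s * g \<beta> s"
        using gp(2)[OF \<beta>] by eventually_elim simp
    qed
    finally show ?thesis by (simp add: g_def)
  qed
  then have "net_integral N (\<lambda>\<beta> s. \<mu> \<beta> * net_deriv N m \<beta> s * net_deriv N ?v \<beta> s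
      + on_edge N b \<beta> s * on_edge N m \<beta> s * net_deriv N ?v \<beta> s) = (\<integral>s. ?h \<alpha> s * deriv \<phi> s \<partial>leb_edge N \<alpha>)"
    unfolding net_integral_def using \<alpha> finite_idx by simp
  then show "(\<integral>s. ?h \<alpha> s * deriv \<phi> s \<partial>leb_edge N \<alpha>) = 0"
    using weak v unfolding weak_equation_def by simp
qed (rule that)

text \<open>Linear interpolation along each edge.\<close>
lemma ex_V12_with_vertex_values:
  obtains v where "v \<in> V12 N" "has_vertex_values (\<lambda>_ _. 1) v \<psi>"
proof -
  define g :: "'i \<Rightarrow> real \<Rightarrow> real" where "g = (\<lambda>\<alpha> s. (\<psi> (tgt N \<alpha>) - \<psi> (src N \<alpha>)) / edge_length N \<alpha>)"
  define f where "f \<alpha> s = \<psi> (src N \<alpha>) + s * ((\<psi> (tgt N \<alpha>) - \<psi> (src N \<alpha>)) / edge_length N \<alpha>)" for \<alpha> s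
  have L2: "g \<alpha> \<in> L2_interval (edge_length N \<alpha>)" for \<alpha>
    unfolding g_def by (intro continuous_imp_L2 continuous_intros)
  have eq: "\<forall>\<alpha>\<in>idx N. \<forall>s\<in>{0..edge_length N \<alpha>}. f \<alpha> s = \<psi> (src N \<alpha>) + integral {0..s} (g \<alpha>)"
    by (simp add: f_def g_def)
  note gp = glue_primitive[of g f "\<lambda>\<alpha>. \<psi> (src N \<alpha>)", OF ballI[OF L2] eq]
  have "has_vertex_values (\<lambda>_ _. 1) (glue f) \<psi>"
    unfolding has_vertex_values_iff
  proof (intro ballI)
    fix \<alpha> assume \<alpha>: "\<alpha> \<in> idx N"
    have "f \<alpha> 0 = \<psi> (src N \<alpha>)" "f \<alpha> (edge_length N \<alpha>) = \<psi> (tgt N \<alpha>)"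
      using edge_length_pos[OF \<alpha>] by (simp_all add: f_def)
    then show "edge_trace N (glue f) \<alpha> (src N \<alpha>) = (if src N \<alpha> \<in> boundary_verts N then 1 else 1) * \<psi> (src N \<alpha>) \<and>
       edge_trace N (glue f) \<alpha> (tgt N \<alpha>) = (if tgt N \<alpha> \<in> boundary_verts N then 1 else 1) * \<psi> (tgt N \<alpha>)"
      using gp(3,4)[OF \<alpha>] by simp
  qed
  then show thesis using that V12I gp(1) by blast
qed

text \<open>
  The flux on each edge is constant, so \<open>m\<close> is a profile there; its end values determine the flux,
  and interpolating test functions show that these fluxes balance.
\<close>
lemma weak_equation_imp_sol:
  assumes m: "m \<in> V12_jump N \<gamma>" and weak: "weak_equation m"
  obtains T where "balanced T" "has_vertex_values \<gamma> m T"
    "\<forall>\<alpha>\<in>idx N. AE s in leb_edge N \<alpha>. on_edge N m \<alpha> s = edge_sol T \<alpha> s"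
proof -
  have W: "m \<in> W12 N" using m by (simp add: V12_jump_def)
  obtain T where T: "has_vertex_values \<gamma> m T" using V12_jump_vertex_values[OF m \<gamma>_nonzero] by blast
  have "\<exists>c. AE s in leb_edge N \<alpha>. \<mu> \<alpha> * net_deriv N m \<alpha> s + on_edge N b \<alpha> s * on_edge N m \<alpha> s = c"
    if "\<alpha> \<in> idx N" for \<alpha>
    using constant_flux_if_weak_equation[OF W weak that] by blast
  then obtain c where c: "\<And>\<alpha>. \<alpha> \<in> idx N \<Longrightarrow> AE s in leb_edge N \<alpha>.
      \<mu> \<alpha> * net_deriv N m \<alpha> s + on_edge N b \<alpha> s * on_edge N m \<alpha> s = c \<alpha>" by metis
  have flux: "c \<alpha> = flux T \<alpha>" and AE_sol: "AE s in leb_edge N \<alpha>. on_edge N m \<alpha> s = edge_sol T \<alpha> s"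
    if \<alpha>: "\<alpha> \<in> idx N" for \<alpha>
  proof -
    let ?L = "edge_length N \<alpha>" and ?g = "net_deriv N m \<alpha>"
    note L = edge_length_pos[OF \<alpha>] and d = continuous_drift[OF \<alpha>]
    define a where "a = vertex_weight (src N \<alpha>) \<alpha> * T (src N \<alpha>)"
    have tr: "edge_trace N m \<alpha> (src N \<alpha>) = a" "edge_trace N m \<alpha> (tgt N \<alpha>) = vertex_weight (tgt N \<alpha>) \<alpha> * T (tgt N \<alpha>)"
      using T \<alpha> unfolding has_vertex_values_iff vertex_weight_def a_def by auto
    note prim = W12_edge_primitive[OF W \<alpha>, unfolded tr]
    define F where "F s = a + integral {0..s} ?g" for s
    have "AE s in leb_edge N \<alpha>. ?g s = c \<alpha> / \<mu> \<alpha> - drift \<alpha> s * F s"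
    proof -
      have "AE s in leb_edge N \<alpha>. on_edge N m \<alpha> s = F s \<and> 
          \<mu> \<alpha> * ?g s + on_edge N b \<alpha> s * on_edge N m \<alpha> s = c \<alpha>"
        using prim(2) c[OF \<alpha>] unfolding F_def by eventually_elim simp
      then show ?thesis
      proof (rule lebesgue_on_mono)
        fix s assume s: "on_edge N m \<alpha> s = F s \<and> \<mu> \<alpha> * ?g s + on_edge N b \<alpha> s * on_edge N m \<alpha> s = c \<alpha>"
          "s \<in> {0<..<?L}"
        then have m_eq: "on_edge N m \<alpha> s = F s" and "\<mu> \<alpha> * ?g s + on_edge N b \<alpha> s * on_edge N m \<alpha> s = c \<alpha>"
          by auto
        then have "\<mu> \<alpha> * ?g s + \<mu> \<alpha> * drift \<alpha> s * F s = c \<alpha>"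
          unfolding m_eq on_edge_drift[OF \<alpha> s(2)] by simp
        then show "?g s = c \<alpha> / \<mu> \<alpha> - drift \<alpha> s * F s" using \<mu>_pos[OF \<alpha>] by (simp add: field_simps)
      qed
    qed
    then have F: "F s = profile (drift \<alpha>) a (c \<alpha> / \<mu> \<alpha>) s" if "s \<in> {0..?L}" for s
      by (rule profile_unique[OF L d L2_imp_integrable[OF prim(1)] F_def _ that])
    have "profile (drift \<alpha>) a (c \<alpha> / \<mu> \<alpha>) ?L = vertex_weight (tgt N \<alpha>) \<alpha> * T (tgt N \<alpha>)"
      using F[of ?L] L prim(3) by (simp add: F_def)
    then have "c \<alpha> / \<mu> \<alpha> = flux T \<alpha> / \<mu> \<alpha>"
      using slope_from_end_value[OF L d, of "c \<alpha> / \<mu> \<alpha>" a] unfolding flux_eq[OF \<alpha>] a_def by simp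
    then show eq: "c \<alpha> = flux T \<alpha>" using \<mu>_pos[OF \<alpha>] by simp
    show "AE s in leb_edge N \<alpha>. on_edge N m \<alpha> s = edge_sol T \<alpha> s"
      by (rule lebesgue_on_mono[OF prim(2)]) (use F in \<open>simp add: F_def edge_sol_def eq a_def\<close>)
  qed
  have "balanced T" unfolding balanced_def
  proof
    fix \<psi> :: "real ^ 'd \<Rightarrow> real"
    obtain v where v: "v \<in> V12 N" "has_vertex_values (\<lambda>_ _. 1) v \<psi>" by (rule ex_V12_with_vertex_values)
    then have vW: "v \<in> W12 N" by (auto elim: V12E)
    have "(\<Sum>\<alpha>\<in>idx N. c \<alpha> * (\<psi> (tgt N \<alpha>) - \<psi> (src N \<alpha>))) = 0"
      using weak_form_eq_sum[OF W vW v(2) c] weak v(1) unfolding weak_equation_def by simp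
    then show "(\<Sum>\<alpha>\<in>idx N. flux T \<alpha> * (\<psi> (tgt N \<alpha>) - \<psi> (src N \<alpha>))) = 0"
      using flux by simp
  qed
  then show thesis using T AE_sol by (intro that) auto
qed

lemma balanced_imp_weak_equation:
  assumes "balanced T" shows "weak_equation (glue (edge_sol T))"
  unfolding weak_equation_def
proof
  fix v assume "v \<in> V12 N"
  then obtain \<psi> where \<psi>: "v \<in> W12 N" "has_vertex_values (\<lambda>_ _. 1) v \<psi>" by (rule V12E)
  show "net_integral N (\<lambda>\<alpha> s. \<mu> \<alpha> * net_deriv N (glue (edge_sol T)) \<alpha> s * net_deriv N v \<alpha> s
      + on_edge N b \<alpha> s * on_edge N (glue (edge_sol T)) \<alpha> s * net_deriv N v \<alpha> s) = 0"
    using weak_form_eq_sum[OF glue_sol_W12 \<psi> glue_sol_flux] assms by (simp add: balanced_def)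
qed

definition mass :: "(real ^ 'd \<Rightarrow> real) \<Rightarrow> real" where
  "mass T = net_integral N (edge_sol T)"

text \<open>
  Both the mass and the weighted sum of the vertex values are homogeneous in \<open>T\<close>, so the
  normalisation selects one point on the ray of positive balanced \<open>T\<close>.
\<close>
lemma mass_scale:
  assumes "\<And>v. v \<in> verts N \<Longrightarrow> T' v = k * T v"
  shows "mass T' = k * mass T"
  unfolding mass_def net_integral_def sum_distrib_left
proof (rule sum.cong[OF refl])
  fix \<alpha> assume \<alpha>: "\<alpha> \<in> idx N"
  have "edge_sol T' \<alpha> = (\<lambda>s. k * edge_sol T \<alpha> s)" using edge_sol_scale[OF \<alpha> assms] by auto
  then show "(\<integral>s. edge_sol T' \<alpha> s \<partial>leb_edge N \<alpha>) = k * (\<integral>s. edge_sol T \<alpha> s \<partial>leb_edge N \<alpha>)" by simp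
qed

lemma mass_pos:
  assumes T: "\<And>v. v \<in> verts N \<Longrightarrow> 0 < T v"
  shows "0 < mass T"
  unfolding mass_def net_integral_def
proof (rule sum_pos[OF finite_idx])
  show "idx N \<noteq> {}" using verts_nonempty edges_at_nonempty unfolding edges_at_def by blast
  fix \<alpha> assume \<alpha>: "\<alpha> \<in> idx N"
  let ?L = "edge_length N \<alpha>"
  note c = continuous_sol[OF \<alpha>, of T] and L = edge_length_pos[OF \<alpha>]
  have pos: "0 < edge_sol T \<alpha> s" if "s \<in> {0..?L}" for s using edge_sol_pos[OF \<alpha> T that] .
  have "integral {0..?L} (edge_sol T \<alpha>) \<noteq> 0"
    using integral_eq_0_iff[OF c L] pos L by (metis atLeastAtMost_iff less_eq_real_def less_irrefl order_refl)
  moreover have "0 \<le> integral {0..?L} (edge_sol T \<alpha>)"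
    using pos by (intro integral_nonneg integrable_continuous_real c) (auto intro: less_imp_le)
  ultimately show "0 < (\<integral>s. edge_sol T \<alpha> s \<partial>leb_edge N \<alpha>)"
    using integral_ivl_eq[OF integrable_continuous_ivl[OF c]] by simp
qed

lemma net_integral_cong_sol:
  assumes "m \<in> W12 N" "\<And>\<alpha>. \<alpha> \<in> idx N \<Longrightarrow> AE s in leb_edge N \<alpha>. on_edge N m \<alpha> s = edge_sol T \<alpha> s"
  shows "net_integral N (on_edge N m) = mass T"
  unfolding net_integral_def mass_def
proof (rule sum.cong[OF refl])
  fix \<alpha> assume \<alpha>: "\<alpha> \<in> idx N"
  show "(\<integral>s. on_edge N m \<alpha> s \<partial>leb_edge N \<alpha>) = (\<integral>s. edge_sol T \<alpha> s \<partial>leb_edge N \<alpha>)"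
  proof (rule integral_cong_AE)
    show "on_edge N m \<alpha> \<in> borel_measurable (leb_edge N \<alpha>)"
      using assms(1) \<alpha> by (auto simp: W12_def W12_interval_def intro: L2_imp_measurable)
    show "edge_sol T \<alpha> \<in> borel_measurable (leb_edge N \<alpha>)"
      by (rule borel_measurable_integrable[OF integrable_continuous_ivl[OF continuous_sol[OF \<alpha>]]])
    show "AE s in leb_edge N \<alpha>. on_edge N m \<alpha> s = edge_sol T \<alpha> s" by (rule assms(2)[OF \<alpha>])
  qed
qed

text \<open>
  The total mass \<open>mass T + (\<Sum>v. \<eta> v * T v)\<close> of a positive balanced \<open>T\<close> is positive; dividing by it
  gives the solution.  Any other solution has vertex values \<open>k * T v\<close>, and its normalisation forces
  \<open>k = 1\<close>.
\<close>
lemma ex1_weak_solution: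
  "\<exists>m. fp_weak_solution N \<mu> \<eta> \<gamma> b m \<and> (\<forall>m'. fp_weak_solution N \<mu> \<eta> \<gamma> b m' \<longrightarrow> ae_eq N m' m)"
proof -
  define loss where "loss T = (\<Sum>v\<in>inner_verts N. \<eta> v * T v)" for T
  obtain T0 where T0: "balanced T0" "\<And>v. v \<in> verts N \<Longrightarrow> 0 < T0 v" using ex_positive_balanced by blast
  have loss_scale: "loss T' = k * loss T" if "\<And>v. v \<in> verts N \<Longrightarrow> T' v = k * T v" for T' T k
    unfolding loss_def sum_distrib_left using that by (intro sum.cong) auto
  have loss_nonneg: "0 \<le> loss T" if "\<And>v. v \<in> verts N \<Longrightarrow> 0 < T v" for T
    unfolding loss_def
  proof (rule sum_nonneg)
    fix v assume v: "v \<in> inner_verts N"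
    then have "0 < T v" using that by blast
    then show "0 \<le> \<eta> v * T v" using \<eta>_nonneg[OF v] by simp
  qed
  define D where "D = mass T0 + loss T0"
  have D: "0 < D" unfolding D_def using mass_pos[of T0] loss_nonneg[of T0] T0(2) by simp
  define T where "T v = 1 / D * T0 v" for v
  have bal: "balanced T" using balanced_linear[OF T0(1) T0(1), of "1 / D" 0] by (simp add: T_def[abs_def])
  have T_pos: "0 < T v" if "v \<in> verts N" for v using T0(2)[OF that] D by (simp add: T_def)
  have total: "mass T + loss T = 1"
    using mass_scale[of T "1 / D" T0] loss_scale[of T "1 / D" T0] D
    by (simp add: T_def D_def add_divide_distrib[symmetric])
  define m where "m = glue (edge_sol T)"
  have on_m: "on_edge N m \<alpha> s = edge_sol T \<alpha> s" if "\<alpha> \<in> idx N" "s \<in> {0<..<edge_length N \<alpha>}" for \<alpha> s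
    unfolding m_def by (rule on_edge_glue[OF that])
  have m_W: "m \<in> W12 N" and m_T: "has_vertex_values \<gamma> m T"
    unfolding m_def by (rule glue_sol_W12 glue_sol_vertex_values)+
  have m_mass: "net_integral N (on_edge N m) = mass T"
    by (rule net_integral_cong_sol[OF m_W]) (auto intro!: AE_I2 on_m)
  have vals: "(\<Sum>v\<in>inner_verts N. \<eta> v * vertex_value N \<gamma> u v) = loss S" if "has_vertex_values \<gamma> u S" for u S
    unfolding loss_def using vertex_value_eq[OF that _ \<gamma>_nonzero] by (intro sum.cong) auto
  have "fp_weak_solution N \<mu> \<eta> \<gamma> b m"
    unfolding fp_weak_solution_def vals[OF m_T] m_mass
  proof (intro conjI)
    show "m \<in> V12_jump N \<gamma>" by (rule vertex_values_V12_jump[OF m_W m_T \<gamma>_nonzero])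
    show "\<forall>v\<in>V12 N. net_integral N (\<lambda>\<alpha> s. \<mu> \<alpha> * net_deriv N m \<alpha> s * net_deriv N v \<alpha> s
        + on_edge N b \<alpha> s * on_edge N m \<alpha> s * net_deriv N v \<alpha> s) = 0"
      using balanced_imp_weak_equation[OF bal] unfolding weak_equation_def m_def .
    show "ae_on N (\<lambda>x. 0 \<le> m x)" unfolding ae_on_def
    proof
      fix \<alpha> assume \<alpha>: "\<alpha> \<in> idx N"
      show "AE s in leb_edge N \<alpha>. 0 \<le> m (edge_param N \<alpha> s)"
        using on_m[OF \<alpha>] edge_sol_pos[OF \<alpha> T_pos] unfolding on_edge_def by (intro AE_I2) (simp add: less_imp_le)
    qed
    show "mass T \<le> 1" "mass T = 1 - loss T" "0 \<le> 1 - loss T"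
      using total loss_nonneg[of T] mass_pos[of T] T_pos by auto
  qed
  moreover have "ae_eq N m' m" if m': "fp_weak_solution N \<mu> \<eta> \<gamma> b m'" for m'
  proof -
    have J: "m' \<in> V12_jump N \<gamma>" and weak: "weak_equation m'"
      using m' unfolding fp_weak_solution_def weak_equation_def by - (elim conjE, assumption)+
    have norm: "net_integral N (on_edge N m') = 1 - (\<Sum>v\<in>inner_verts N. \<eta> v * vertex_value N \<gamma> m' v)"
      using m' unfolding fp_weak_solution_def by (elim conjE)
    obtain T' where T': "balanced T'" "has_vertex_values \<gamma> m' T'"
      "\<forall>\<alpha>\<in>idx N. AE s in leb_edge N \<alpha>. on_edge N m' \<alpha> s = edge_sol T' \<alpha> s"
      by (rule weak_equation_imp_sol[OF J weak])
    obtain k where k: "\<And>v. v \<in> verts N \<Longrightarrow> T' v = k * T v"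
      using balanced_proportional[OF bal T'(1) T_pos] by blast
    have "m' \<in> W12 N" using J by (simp add: V12_jump_def)
    then have "mass T' = 1 - loss T'" using norm net_integral_cong_sol[of m' T'] T' vals by simp
    then have "k * (mass T + loss T) = 1"
      using mass_scale[OF k] loss_scale[OF k] by (simp add: algebra_simps)
    then have "k = 1" using total by simp
    then have same: "edge_sol T' \<alpha> s = edge_sol T \<alpha> s" if "\<alpha> \<in> idx N" for \<alpha> s using edge_sol_scale[OF that k] by simp
    show ?thesis unfolding ae_eq_def ae_on_def
    proof
      fix \<alpha> assume \<alpha>: "\<alpha> \<in> idx N"
      show "AE s in leb_edge N \<alpha>. m' (edge_param N \<alpha> s) = m (edge_param N \<alpha> s)"
        by (rule lebesgue_on_mono[OF bspec[OF T'(3) \<alpha>]])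
          (use on_m[OF \<alpha>] same[OF \<alpha>] in \<open>simp add: on_edge_def\<close>)
    qed
  qed
  ultimately show ?thesis by blast
qed

end

theorem proposition3p6:
  fixes N :: "('d::finite, 'i) network"
    and \<mu> :: "'i \<Rightarrow> real"
    and \<eta> :: "real ^ 'd \<Rightarrow> real"
    and \<gamma> :: "real ^ 'd \<Rightarrow> 'i \<Rightarrow> real"
    and b :: "real ^ 'd \<Rightarrow> real"
  assumes "is_network N"
    and "fp_parameters N \<mu> \<eta> \<gamma>"
    and "b \<in> PC N"
  shows "\<exists>m. fp_weak_solution N \<mu> \<eta> \<gamma> b m \<and>
             (\<forall>m'. fp_weak_solution N \<mu> \<eta> \<gamma> b m' \<longrightarrow> ae_eq N m' m)"
proof -
  interpret fokker_planck N \<mu> \<eta> \<gamma> b by unfold_locales fact+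
  show ?thesis by (rule ex1_weak_solution)
qed

end
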